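(* Let $W \in \mathcal{P}(\mathcal{Y}|\mathcal{X})$ be a symmetric and singular discrete memoryless channel with $R_{\mathrm{cr}} < C(W)$. (i) For every $R$ with $R_{\mathrm{cr}} < R < C(W)$ there is a constant $K_2>0$ (depending on $W$ and $R$) such that for every blocklength $N$, $$\mathrm{P}_{\mathrm{e}}(N,R) \le \frac{K_2}{\sqrt{N}}\exp\{-N\,\mathrm{E}_{\mathrm{r}}(R)\}.$$ (ii) For every $R$ with $R_\infty < R < C(W)$ there is a constant $\tilde K_2>0$ (depending on $W$ and $R$) such that for every blocklength $N$, $$\bar{\mathrm{P}}_{\mathrm{e,fb}}(N,R) \ge \frac{\tilde K_2}{\sqrt{N}}\exp\{-N\,\mathrm{E}_{\mathrm{SP}}(R)\}.$$
   Context: $\mathcal{X},\mathcal{Y}$ are finite sets; $\mathcal{P}(\mathcal{Y}|\mathcal{X})$ is the set of channels from $\mathcal{X}$ to $\mathcal{Y}$, used memorylessly. A channel is symmetric (in Gallager's sense) if its output set can be partitioned into subsets such that, within each subset, in the submatrix of transition probabilities each row is a permutation of each other row and each column is a permutation of each other column. A symmetric channel is singular if for all $(x,y,z)$ with $W(y|x)W(y|z)>0$ we have $W(y|x)=W(y|z)$. An $(N,R)$ code: encoder $f:\mathcal{M}\to\mathcal{X}^N$, $\mathcal{M}=\{1,\dots,\lceil e^{NR}\rceil\}$, decoder $\varphi:\mathcal{Y}^N\to\mathcal{M}$; $\mathrm{P}_{\mathrm{e}}(N,R)$ is the minimum maximal error probability over $(N,R)$ codes. An $(N,R)$ code with ideal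 feedback: encoding maps $f_n:\mathcal{M}\times\mathcal{Y}^{n-1}\to\mathcal{X}$ and decoder $\varphi$; output law given $m$ is $\prod_n W(y_n|f_n(m,\mathbf{y}^{n-1}))$; $\bar{\mathrm{P}}_{\mathrm{e,fb}}(N,R)$ is the minimum average (uniform over messages) error probability over such codes. $\mathrm{E}_{\mathrm{o}}(\rho,Q)=-\ln\sum_y\big(\sum_x Q(x)W(y|x)^{1/(1+\rho)}\big)^{1+\rho}$; $\mathrm{E}_{\mathrm{r}}(R)=\max_Q\max_{0\le\rho\le1}\{\mathrm{E}_{\mathrm{o}}(\rho,Q)-\rho R\}$; $\mathrm{E}_{\mathrm{SP}}(R)=\max_Q\min_{V:I(Q;V)\le R}D(V\|W|Q)$ with $D(V\|W|Q)=\sum_xQ(x)D(V(\cdot|x)\|W(\cdot|x))$. $R_\infty$ is the largest rate below which $\mathrm{E}_{\mathrm{SP}}=\infty$; $R_{\mathrm{cr}}$ is the critical rate ($\mathrm{E}_{\mathrm{r}}(R)=\mathrm{E}_{\mathrm{SP}}(R)$ iff $R\ge R_{\mathrm{cr}}$); $C(W)$ is the capacity. *)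

theory Defs
  imports "HOL-Analysis.Analysis" "HOL-Library.Disjoint_Sets"
begin

definition is_channel :: "('x::finite \<Rightarrow> 'y::finite \<Rightarrow> real) \<Rightarrow> bool" where
  "is_channel W \<longleftrightarrow> (\<forall>x y. 0 \<le> W x y) \<and> (\<forall>x. (\<Sum>y\<in>UNIV. W x y) = 1)"

definition pdist :: "('x::finite \<Rightarrow> real) \<Rightarrow> bool" where
  "pdist Q \<longleftrightarrow> (\<forall>x. 0 \<le> Q x) \<and> (\<Sum>x\<in>UNIV. Q x) = 1"

text \<open>Gallager symmetry: a partition of the output alphabet such that in each
  submatrix rows are permutations of each other and columns are permutations of each other.\<close>
definition symmetric_channel :: "('x::finite \<Rightarrow> 'y::finite \<Rightarrow> real) \<Rightarrow> bool" where
  "symmetric_channel W \<longleftrightarrow>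
     (\<exists>P. partition_on (UNIV :: 'y set) P \<and>
       (\<forall>S\<in>P.
          (\<forall>x x'. \<exists>\<sigma>. bij_betw \<sigma> S S \<and> (\<forall>y\<in>S. W x' y = W x (\<sigma> y))) \<and>
          (\<forall>y\<in>S. \<forall>y'\<in>S. \<exists>\<pi>::'x \<Rightarrow> 'x. bij \<pi> \<and> (\<forall>x. W x y' = W (\<pi> x) y))))"

definition singular_channel :: "('x::finite \<Rightarrow> 'y::finite \<Rightarrow> real) \<Rightarrow> bool" where
  "singular_channel W \<longleftrightarrow> (\<forall>x y z. W x y * W z y > 0 \<longrightarrow> W x y = W z y)"

definition out_dist :: "('x::finite \<Rightarrow> real) \<Rightarrow> ('x \<Rightarrow> 'y \<Rightarrow> real) \<Rightarrow> 'y \<Rightarrow> real" where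
  "out_dist Q V y = (\<Sum>x\<in>UNIV. Q x * V x y)"

definition mutual_info :: "('x::finite \<Rightarrow> real) \<Rightarrow> ('x \<Rightarrow> 'y::finite \<Rightarrow> real) \<Rightarrow> real" where
  "mutual_info Q V = (\<Sum>x\<in>UNIV. \<Sum>y\<in>UNIV.
      if Q x * V x y = 0 then 0 else Q x * V x y * ln (V x y / out_dist Q V y))"

definition capacity :: "('x::finite \<Rightarrow> 'y::finite \<Rightarrow> real) \<Rightarrow> real" where
  "capacity W = Sup ((\<lambda>Q. mutual_info Q W) ` {Q. pdist Q})"

definition kl_div :: "('y::finite \<Rightarrow> real) \<Rightarrow> ('y \<Rightarrow> real) \<Rightarrow> ereal" where
  "kl_div P P' = (if \<exists>y. P y > 0 \<and> P' y = 0 then \<infinity>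
     else ereal (\<Sum>y\<in>UNIV. if P y = 0 then 0 else P y * ln (P y / P' y)))"

definition cond_div :: "('x::finite \<Rightarrow> real) \<Rightarrow> ('x \<Rightarrow> 'y::finite \<Rightarrow> real) \<Rightarrow> ('x \<Rightarrow> 'y \<Rightarrow> real) \<Rightarrow> ereal" where
  "cond_div Q V W = (\<Sum>x\<in>{x. Q x > 0}. ereal (Q x) * kl_div (V x) (W x))"

definition E_o :: "('x::finite \<Rightarrow> 'y::finite \<Rightarrow> real) \<Rightarrow> real \<Rightarrow> ('x \<Rightarrow> real) \<Rightarrow> real" where
  "E_o W \<rho> Q = - ln (\<Sum>y\<in>UNIV. (\<Sum>x\<in>UNIV. Q x * W x y powr (1 / (1 + \<rho>))) powr (1 + \<rho>))"

definition E_r :: "('x::finite \<Rightarrow> 'y::finite \<Rightarrow> real) \<Rightarrow> real \<Rightarrow> real" where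
  "E_r W R = Sup {E_o W \<rho> Q - \<rho> * R | \<rho> Q. pdist Q \<and> 0 \<le> \<rho> \<and> \<rho> \<le> 1}"

definition E_SP :: "('x::finite \<Rightarrow> 'y::finite \<Rightarrow> real) \<Rightarrow> real \<Rightarrow> ereal" where
  "E_SP W R = (SUP Q\<in>{Q. pdist Q}. INF V\<in>{V. is_channel V \<and> mutual_info Q V \<le> R}. cond_div Q V W)"

definition R_inf :: "('x::finite \<Rightarrow> 'y::finite \<Rightarrow> real) \<Rightarrow> real" where
  "R_inf W = Sup {R. E_SP W R = \<infinity>}"

text \<open>Critical rate: E_r(R) = E_SP(R) iff R >= R_cr.\<close>
definition R_cr :: "('x::finite \<Rightarrow> 'y::finite \<Rightarrow> real) \<Rightarrow> real" where
  "R_cr W = Inf {R. ereal (E_r W R) = E_SP W R}"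

definition msgs :: "nat \<Rightarrow> real \<Rightarrow> nat set" where
  "msgs N R = {1 .. nat \<lceil>exp (real N * R)\<rceil>}"

definition outseqs :: "nat \<Rightarrow> 'y list set" where
  "outseqs N = {ys. length ys = N}"

definition prod_chan :: "('x \<Rightarrow> 'y \<Rightarrow> real) \<Rightarrow> 'x list \<Rightarrow> 'y list \<Rightarrow> real" where
  "prod_chan W xs ys = (\<Prod>i<length ys. W (xs ! i) (ys ! i))"

definition block_code :: "nat \<Rightarrow> real \<Rightarrow> (nat \<Rightarrow> 'x list) \<Rightarrow> ('y list \<Rightarrow> nat) \<Rightarrow> bool" where
  "block_code N R f \<phi> \<longleftrightarrow> (\<forall>m\<in>msgs N R. length (f m) = N) \<and> (\<forall>ys\<in>outseqs N. \<phi> ys \<in> msgs N R)"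

definition code_err :: "('x::finite \<Rightarrow> 'y::finite \<Rightarrow> real) \<Rightarrow> nat \<Rightarrow> (nat \<Rightarrow> 'x list) \<Rightarrow> ('y list \<Rightarrow> nat) \<Rightarrow> nat \<Rightarrow> real" where
  "code_err W N f \<phi> m = (\<Sum>ys\<in>{ys\<in>outseqs N. \<phi> ys \<noteq> m}. prod_chan W (f m) ys)"

definition max_err :: "('x::finite \<Rightarrow> 'y::finite \<Rightarrow> real) \<Rightarrow> nat \<Rightarrow> real \<Rightarrow> (nat \<Rightarrow> 'x list) \<Rightarrow> ('y list \<Rightarrow> nat) \<Rightarrow> real" where
  "max_err W N R f \<phi> = Max ((\<lambda>m. code_err W N f \<phi> m) ` msgs N R)"

definition Pe :: "('x::finite \<Rightarrow> 'y::finite \<Rightarrow> real) \<Rightarrow> nat \<Rightarrow> real \<Rightarrow> real" where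
  "Pe W N R = Inf {max_err W N R f \<phi> | f \<phi>. block_code N R f \<phi>}"

text \<open>Feedback codes: enc m ys is the channel input at time length ys + 1 given message m
  and past outputs ys.\<close>
definition fb_prob :: "('x \<Rightarrow> 'y \<Rightarrow> real) \<Rightarrow> nat \<Rightarrow> (nat \<Rightarrow> 'y list \<Rightarrow> 'x) \<Rightarrow> nat \<Rightarrow> 'y list \<Rightarrow> real" where
  "fb_prob W N enc m ys = (\<Prod>n<N. W (enc m (take n ys)) (ys ! n))"

definition fb_code :: "nat \<Rightarrow> real \<Rightarrow> ('y list \<Rightarrow> nat) \<Rightarrow> bool" where
  "fb_code N R \<phi> \<longleftrightarrow> (\<forall>ys\<in>outseqs N. \<phi> ys \<in> msgs N R)"

definition avg_err_fb :: "('x::finite \<Rightarrow> 'y::finite \<Rightarrow> real) \<Rightarrow> nat \<Rightarrow> real \<Rightarrow> (nat \<Rightarrow> 'y list \<Rightarrow> 'x) \<Rightarrow> ('y list \<Rightarrow> nat) \<Rightarrow> real" where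
  "avg_err_fb W N R enc \<phi> =
     (\<Sum>m\<in>msgs N R. \<Sum>ys\<in>{ys\<in>outseqs N. \<phi> ys \<noteq> m}. fb_prob W N enc m ys) / real (card (msgs N R))"

definition Pe_fb :: "('x::finite \<Rightarrow> 'y::finite \<Rightarrow> real) \<Rightarrow> nat \<Rightarrow> real \<Rightarrow> real" where
  "Pe_fb W N R = Inf {avg_err_fb W N R enc \<phi> | enc \<phi>. fb_code N R \<phi>}"

end

(* The likelihood W(y|x) of a singular channel takes a single positive value in every column y.
   Let q be the output law for the uniform input and z(y) = - ln of the fraction of inputs compatible
   with y; then W(y|x) = q(y) exp(z(y)) whenever W(y|x) > 0, and by symmetry the densities z(y_i) are
   i.i.d. for every encoder, with or without feedback. Hence, for Z = z(y_1) + ... + z(y_N) and M messages,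
     Pe_fb >= E[(1 - exp(Z) / M); Z <= t]                   for every t, and
     Pe    <= E[1; Z <= NR] + M E[exp(-Z); Z > NR],
   the latter by choosing codewords greedily and decoding to the first compatible one.
   Tilting the law of z so that its mean becomes R extracts exp(-N E) from both sides, where E is the
   Chernoff exponent of z at R. It is at most E_SP(R) and, when the tilting parameter is below 1 (which
   R > R_cr ensures), at least E_r(R). What remains is that a window of constant length around the mean of
   the tilted i.i.d. sum has probability of order 1/sqrt N; this follows from Fourier kernels supported in
   [-1, 1], with no distinction between lattice and non-lattice laws. *)
theory Submission
  imports Defs
begin

text \<open>If \<open>z\<close> lives on a lattice, its characteristic function has modulus 1 at
  points far from the origin, so no Gaussian bound holds there. Kernels supported in [-1, 1] and
  rescaled by a small \<open>s\<close> see the characteristic function near the origin only, where a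
  Taylor expansion controls it for every nondegenerate law. The price is that such kernels resolve
  windows of length of order 1/s and nothing shorter. This is harmless here: on a window of constant
  length the factor \<open>exp (\<rho> * S)\<close> left over by tilting varies by a constant factor
  only. With D = Z - NR, the weights of the achievability bound become at most a constant times
  exp(\<rho> D) for D \<le> 0 and exp(-(1 - \<rho>) D) for D > 0. Both decay away from D = 0 exactly
  when 0 < \<rho> < 1, and then the sum is governed by the mass near the mean. The exponents are
  compared without solving the optimisations over input laws and auxiliary channels: Bernoulli's
  inequality bounds \<open>E_o\<close> for all inputs at once, and ln u \<le> u - 1 bounds the
  divergence for all auxiliary channels at once.\<close>

section \<open>Sums and products over output sequences\<close>

lemma finite_outseqs [simp]: "finite (outseqs N :: 'y::finite list set)"
  using finite_lists_length_eq[of "UNIV :: 'y set" N] by (simp add: outseqs_def)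

lemma outseqs_0 [simp]: "outseqs 0 = {[]}"
  by (auto simp: outseqs_def)

lemma sum_outseqs_Suc:
  "(\<Sum>ys\<in>outseqs (Suc N). F ys) = (\<Sum>ys\<in>outseqs N. \<Sum>y\<in>UNIV. F (ys @ [y :: 'y::finite]))"
proof -
  have "(\<Sum>ys\<in>outseqs (Suc N). F ys) = (\<Sum>(ys, y)\<in>outseqs N \<times> (UNIV :: 'y set). F (ys @ [y]))"
    by (rule sum.reindex_bij_witness[of _ "\<lambda>(ys, y). ys @ [y]" "\<lambda>ys. (butlast ys, last ys)"])
       (auto simp: outseqs_def append_butlast_last_id simp flip: length_greater_0_conv)
  then show ?thesis
    by (simp add: sum.cartesian_product)
qed

lemma sum_outseqs_prod_list:
  fixes h :: "'y::finite \<Rightarrow> 'a::comm_semiring_1"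
  shows "(\<Sum>ys\<in>outseqs N. prod_list (map h ys)) = (\<Sum>y\<in>UNIV. h y) ^ N"
proof (induction N)
  case (Suc N)
  then show ?case
    by (simp add: sum_outseqs_Suc mult.commute flip: sum_distrib_left sum_distrib_right)
qed simp

lemma prod_list_mult_map:
  fixes f g :: "'a \<Rightarrow> 'b::comm_monoid_mult"
  shows "prod_list (map (\<lambda>y. f y * g y) ys) = prod_list (map f ys) * prod_list (map g ys)"
  by (induction ys) (simp_all add: ac_simps)

lemma prod_list_exp: "prod_list (map (\<lambda>y. exp (f y)) ys) = exp (sum_list (map f ys) :: real)"
  by (induction ys) (simp_all add: exp_add)

lemma prod_list_map_nonneg:
  "(\<And>y. 0 \<le> f y) \<Longrightarrow> 0 \<le> prod_list (map f ys :: real list)"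
  by (induction ys) simp_all

section \<open>Fourier kernels and Gaussian integrals\<close>

text \<open>Integration by parts. The transform is nonnegative, so it can serve in a majorant; its
  value at 0 is listed apart because division by zero would give 0.\<close>

lemma fejer_integral:
  fixes x :: real
  shows "((\<lambda>t. (1 - t) * cos (t * x)) has_integral (if x = 0 then 1/2 else (1 - cos x) / x\<^sup>2)) {0..1}"
proof (cases "x = 0")
  case True
  have "((\<lambda>t::real. 1 - t) has_integral (1 - 1\<^sup>2/2) - (0 - 0\<^sup>2/2)) {0..1}"
    by (rule fundamental_theorem_of_calculus)
       (auto intro!: derivative_eq_intros simp flip: has_real_derivative_iff_has_vector_derivative)
  then show ?thesis using True by simp
next
  case False
  have "((\<lambda>t. (1 - t) * cos (t * x)) has_integral
      ((1 - 1) * sin (1 * x) / x - cos (1 * x) / x\<^sup>2) - ((1 - 0) * sin (0 * x) / x - cos (0 * x) / x\<^sup>2)) {0..1}"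
    by (rule fundamental_theorem_of_calculus)
       (use False in \<open>auto intro!: derivative_eq_intros
          simp: power2_eq_square field_simps simp flip: has_real_derivative_iff_has_vector_derivative\<close>)
  then show ?thesis using False by (simp add: diff_divide_distrib)
qed

text \<open>A continuous kernel on \<open>[0, 1]\<close> whose cosine transform
  \<open>(1 - cos x) * 4 pi^2 / (x^2 * (4 pi^2 - x^2))\<close> is positive only for \<open>\<bar>x\<bar> \<le> 2 * pi\<close>.\<close>
definition minorant_kernel :: "real \<Rightarrow> real" where
  "minorant_kernel t = (1 - t) + sin (2 * pi * t) / (2 * pi)"

text \<open>With P = 2 pi, the sine term contributes (1 - cos x) / (P^2 - x^2). Beyond P this is
  nonpositive and at least as large in modulus as the Fejer term (1 - cos x) / x^2.\<close>

lemma minorant_integral_nonpos: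
  fixes x :: real
  assumes x: "\<bar>x\<bar> > 2 * pi"
  shows "integral {0..1} (\<lambda>t. minorant_kernel t * cos (t * x)) \<le> 0"
proof -
  define P where "P = 2 * pi"
  have P: "P > 0" "\<bar>x\<bar> > P" using x by (simp_all add: P_def)
  have cP: "cos (P + x) = cos x" "cos (P - x) = cos x"
    by (simp_all add: P_def cos_add cos_diff)
  have nz: "P + x \<noteq> 0" "P - x \<noteq> 0" "x \<noteq> 0" "P \<noteq> 0" using P by auto
  have sq: "P\<^sup>2 < x\<^sup>2" using P by (metis abs_ge_zero abs_of_pos power2_abs power_strict_mono zero_less_numeral pos2 less_imp_le)
  have si: "((\<lambda>t. sin (t * A)) has_integral (1 - cos A) / A) {0..1}" if "A \<noteq> 0" for A :: real
  proof -
    have "((\<lambda>t. sin (t * A)) has_integral - cos (1 * A) / A - - cos (0 * A) / A) {0..1}"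
      by (rule fundamental_theorem_of_calculus)
         (use that in \<open>auto intro!: derivative_eq_intros
            simp flip: has_real_derivative_iff_has_vector_derivative\<close>)
    then show ?thesis using that by (simp add: diff_divide_distrib)
  qed
  have sc: "sin (P * t) * cos (t * x) = 1 / 2 * (sin (t * (P + x)) + sin (t * (P - x)))" for t
    by (simp add: ring_distribs sin_add sin_diff mult.commute)
  have "((\<lambda>t. sin (P * t) * cos (t * x)) has_integral
      1 / 2 * ((1 - cos (P + x)) / (P + x) + (1 - cos (P - x)) / (P - x))) {0..1}"
    unfolding sc using nz by (intro has_integral_mult_right has_integral_add si)
  moreover have "1 / 2 * ((1 - cos (P + x)) / (P + x) + (1 - cos (P - x)) / (P - x)) =
      (1 - cos x) * P / (P\<^sup>2 - x\<^sup>2)"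
  proof -
    have "1 / 2 * ((1 - cos (P + x)) / (P + x) + (1 - cos (P - x)) / (P - x)) =
        (1 - cos x) / 2 * (1 / (P + x) + 1 / (P - x))"
      by (simp only: cP) (simp add: distrib_left)
    also have "1 / (P + x) + 1 / (P - x) = 2 * P / ((P + x) * (P - x))"
      using nz by (subst add_frac_eq) (auto simp: algebra_simps)
    also have "(P + x) * (P - x) = P\<^sup>2 - x\<^sup>2"
      by (simp add: algebra_simps power2_eq_square)
    finally show ?thesis by simp
  qed
  ultimately have "((\<lambda>t. (1 / P) * (sin (P * t) * cos (t * x))) has_integral
      (1 / P) * ((1 - cos x) * P / (P\<^sup>2 - x\<^sup>2))) {0..1}"
    by (intro has_integral_mult_right) (simp only:)
  then have "((\<lambda>t. (1 - t) * cos (t * x) + (1 / P) * (sin (P * t) * cos (t * x))) has_integral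
      (1 - cos x) / x\<^sup>2 + (1 / P) * ((1 - cos x) * P / (P\<^sup>2 - x\<^sup>2))) {0..1}"
    using fejer_integral[of x] nz by (intro has_integral_add) auto
  moreover have "(1 - cos x) / x\<^sup>2 + (1 / P) * ((1 - cos x) * P / (P\<^sup>2 - x\<^sup>2)) =
      (1 - cos x) * (1 / x\<^sup>2 - 1 / (x\<^sup>2 - P\<^sup>2))"
    using nz sq by (simp add: divide_simps) (simp add: algebra_simps)
  moreover have "(1 - cos x) * (1 / x\<^sup>2 - 1 / (x\<^sup>2 - P\<^sup>2)) \<le> 0"
    using sq nz by (intro mult_nonneg_nonpos) (auto intro!: divide_left_mono)
  moreover have "minorant_kernel t * cos (t * x) =
      (1 - t) * cos (t * x) + (1 / P) * (sin (P * t) * cos (t * x))" for t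
    by (simp add: minorant_kernel_def P_def ring_distribs)
  ultimately show ?thesis
    by (simp only: integral_unique)
qed

lemma abs_minorant_kernel_le: "t \<in> {0..1} \<Longrightarrow> \<bar>minorant_kernel t\<bar> \<le> 2"
proof -
  assume t: "t \<in> {0..1}"
  have "\<bar>sin (2 * pi * t)\<bar> \<le> 2 * pi"
    using abs_sin_le_one[of "2 * pi * t"] pi_gt3 by linarith
  then have "\<bar>sin (2 * pi * t) / (2 * pi)\<bar> \<le> 1"
    by (simp add: abs_divide)
  moreover have "\<bar>1 - t\<bar> \<le> 1"
    using t by auto
  ultimately show ?thesis
    unfolding minorant_kernel_def by linarith
qed

lemma continuous_minorant_kernel [continuous_intros]: "continuous_on S minorant_kernel"
  unfolding minorant_kernel_def by (intro continuous_intros) simp_all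

lemma abs_integral_minorant_le:
  "\<bar>integral {0..1} (\<lambda>t. minorant_kernel t * cos (t * x))\<bar> \<le> 2"
proof -
  have "norm (integral {0..1} (\<lambda>t. minorant_kernel t * cos (t * x))) \<le> integral {0..1} (\<lambda>t::real. 2)"
  proof (rule integral_norm_bound_integral)
    fix t :: real assume "t \<in> {0..1}"
    then show "norm (minorant_kernel t * cos (t * x)) \<le> 2"
      using mult_mono[OF abs_minorant_kernel_le abs_cos_le_one, of t "t * x"] by (simp add: abs_mult)
  qed (auto intro!: integrable_continuous_interval continuous_intros)
  then show ?thesis by simp
qed

text \<open>The Fejer transform vanishes at the nonzero multiples of 2 pi, so a copy shifted by pi
  is added: the numerators 1 - cos x and 1 + cos x sum to 2. What remains is quadratic decay,
  compared with the exponential through u^2 / 2 \<le> exp u at u = \<beta> (|x| + pi); this is the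
  origin of the constant.\<close>

lemma exp_abs_le_fejer:
  fixes \<beta> :: real
  assumes "\<beta> > 0"
  obtains C where "C > 0" "\<And>x. exp (- \<beta> * \<bar>x\<bar>) \<le>
    C * integral {0..1} (\<lambda>t. (1 - t) * cos (t * x) + (1 - t) * cos (t * (x + pi)))"
proof
  let ?C = "exp (\<beta> * pi) / \<beta>\<^sup>2"
  show "?C > 0" using assms by simp
  define K where "K x = (if x = 0 then 1/2 else (1 - cos x) / x\<^sup>2)" for x :: real
  fix x :: real
  have int: "integral {0..1} (\<lambda>t. (1 - t) * cos (t * x) + (1 - t) * cos (t * (x + pi))) = K x + K (x + pi)"
    unfolding K_def by (intro integral_unique has_integral_add fejer_integral)
  have sq: "(\<bar>x\<bar> + pi)\<^sup>2 > 0" using pi_gt_zero by (intro zero_less_power add_nonneg_pos) auto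
  have "K x + K (x + pi) \<ge> 2 / (\<bar>x\<bar> + pi)\<^sup>2"
  proof -
    consider "x = 0" | "x = - pi" | "x \<noteq> 0" "x + pi \<noteq> 0" by linarith
    then show ?thesis
    proof cases
      case 1 then show ?thesis by (simp add: K_def)
    next
      case 2
      then have "K x + K (x + pi) = 2 / pi\<^sup>2 + 1/2" "(\<bar>x\<bar> + pi)\<^sup>2 = 4 * pi\<^sup>2"
        by (simp_all add: K_def power2_eq_square)
      moreover have "pi\<^sup>2 > 0" by simp
      ultimately show ?thesis by (simp only:) (simp add: divide_simps)
    next
      case 3
      have "(1 - cos x) / x\<^sup>2 \<ge> (1 - cos x) / (\<bar>x\<bar> + pi)\<^sup>2"
        using 3 by (intro divide_left_mono mult_pos_pos sq) (auto intro!: power2_le_iff_abs_le[THEN iffD2])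
      moreover have "0 \<le> 1 + cos x"
        using cos_ge_minus_one[of x] by linarith
      then have "(1 + cos x) / (x + pi)\<^sup>2 \<ge> (1 + cos x) / (\<bar>x\<bar> + pi)\<^sup>2"
        using 3 abs_triangle_ineq[of x pi]
          by (intro divide_left_mono mult_pos_pos sq) (auto intro!: power2_le_iff_abs_le[THEN iffD2])
      ultimately have "K x + K (x + pi) \<ge> (1 - cos x) / (\<bar>x\<bar> + pi)\<^sup>2 + (1 + cos x) / (\<bar>x\<bar> + pi)\<^sup>2"
        using 3 by (simp add: K_def)
      then show ?thesis by (simp add: add_divide_distrib[symmetric])
    qed
  qed
  moreover have "exp (- \<beta> * \<bar>x\<bar>) \<le> ?C * (2 / (\<bar>x\<bar> + pi)\<^sup>2)"
  proof -
    have "(\<beta> * (\<bar>x\<bar> + pi))\<^sup>2 / 2 \<le> exp (\<beta> * (\<bar>x\<bar> + pi))"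
      using exp_lower_Taylor_quadratic[of "\<beta> * (\<bar>x\<bar> + pi)"] assms pi_gt_zero
      by (smt (verit) mult_nonneg_nonneg)
    then have "\<beta>\<^sup>2 * (\<bar>x\<bar> + pi)\<^sup>2 \<le> 2 * exp (\<beta> * (\<bar>x\<bar> + pi))"
      by (simp add: power_mult_distrib)
    also have "\<dots> = 2 * (exp (\<beta> * \<bar>x\<bar>) * exp (\<beta> * pi))"
      by (simp add: distrib_left exp_add)
    finally have "\<beta>\<^sup>2 * (\<bar>x\<bar> + pi)\<^sup>2 \<le> 2 * (exp (\<beta> * \<bar>x\<bar>) * exp (\<beta> * pi))" .
    then show ?thesis
      using assms sq by (simp add: exp_minus field_simps)
  qed
  ultimately show "exp (- \<beta> * \<bar>x\<bar>) \<le>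
    ?C * integral {0..1} (\<lambda>t. (1 - t) * cos (t * x) + (1 - t) * cos (t * (x + pi)))"
    using mult_left_mono[of "2 / (\<bar>x\<bar> + pi)\<^sup>2" "K x + K (x + pi)" ?C] int by force
qed

text \<open>The integrand lies below 1 / (1 + b t^2), whose primitive is an arctangent and hence
  bounded by pi / 2 up to scaling.\<close>

lemma gaussian_integral_le:
  fixes b :: real
  assumes "b > 0"
  shows "integral {0..1} (\<lambda>t. exp (- b * t\<^sup>2)) \<le> pi / (2 * sqrt b)"
proof -
  have d: "1 + (sqrt b * t)\<^sup>2 > 0" for t :: real
    by (intro add_pos_nonneg) simp_all
  have "((\<lambda>t. 1 / (1 + (sqrt b * t)\<^sup>2)) has_integral
      arctan (sqrt b * 1) / sqrt b - arctan (sqrt b * 0) / sqrt b) {0..1}"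
    by (rule fundamental_theorem_of_calculus)
       (use assms in \<open>auto intro!: derivative_eq_intros
         simp: inverse_eq_divide simp flip: has_real_derivative_iff_has_vector_derivative\<close>)
  moreover have "exp (- b * t\<^sup>2) \<le> 1 / (1 + (sqrt b * t)\<^sup>2)" for t
  proof -
    have "1 + (sqrt b * t)\<^sup>2 \<le> exp (b * t\<^sup>2)"
      using exp_ge_add_one_self[of "b * t\<^sup>2"] assms by (simp add: power_mult_distrib)
    then show ?thesis
      using d[of t] by (simp add: exp_minus field_simps)
  qed
  ultimately have "integral {0..1} (\<lambda>t. exp (- b * t\<^sup>2)) \<le> arctan (sqrt b * 1) / sqrt b - arctan (sqrt b * 0) / sqrt b"
    by (intro has_integral_le[OF integrable_integral[OF integrable_continuous_interval]])
       (auto intro!: continuous_intros)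
  also have "\<dots> = arctan (sqrt b) / sqrt b" by simp
  also have "\<dots> \<le> (pi / 2) / sqrt b"
    using arctan_ubound[of "sqrt b"] assms by (intro divide_right_mono) auto
  finally show ?thesis by simp
qed

text \<open>Only [0, 1 / sqrt N] is kept, where the exponent is at least - b.\<close>

lemma gaussian_integral_ge:
  fixes b :: real
  assumes "b > 0" and N: "N \<ge> (1::nat)"
  shows "exp (- b) / sqrt N \<le> integral {0..1} (\<lambda>t. exp (- b * N * t\<^sup>2))"
proof -
  have "exp (- b) / sqrt N = integral {0..1 / sqrt N} (\<lambda>t. exp (- b))"
    by simp
  also have "\<dots> \<le> integral {0..1 / sqrt N} (\<lambda>t. exp (- b * N * t\<^sup>2))"
  proof (rule integral_le)
    fix t assume t: "t \<in> {0..1 / sqrt N}"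
    then have "t\<^sup>2 \<le> (1 / sqrt N)\<^sup>2" by (intro power_mono) auto
    then have "N * t\<^sup>2 \<le> 1" using N by (simp add: power_divide field_simps)
    then show "exp (- b) \<le> exp (- b * N * t\<^sup>2)" using assms by (simp add: mult.assoc)
  qed (auto intro!: integrable_continuous_interval continuous_intros)
  also have "\<dots> \<le> integral {0..1} (\<lambda>t. exp (- b * N * t\<^sup>2))"
    using N by (intro integral_subset_le) (auto intro!: integrable_continuous_interval continuous_intros)
  finally show ?thesis .
qed

text \<open>This moment and the third one bound the errors in \<open>window_lower_bound\<close>.
  There b is of order N and the third moment carries a factor N, so both errors are of order 1/N,
  below the main term of order 1 / sqrt N.\<close>

lemma gaussian_first_moment_le:
  fixes b :: real
  assumes "b > 0"
  shows "integral {0..1} (\<lambda>t. t * exp (- b * t\<^sup>2)) \<le> 1 / (2 * b)"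
proof -
  have "((\<lambda>t. t * exp (- b * t\<^sup>2)) has_integral
      - exp (- b * 1\<^sup>2) / (2 * b) - - exp (- b * 0\<^sup>2) / (2 * b)) {0..1}"
    by (rule fundamental_theorem_of_calculus)
       (use assms in \<open>auto intro!: derivative_eq_intros simp: divide_simps
         simp flip: has_real_derivative_iff_has_vector_derivative\<close>)
  moreover have "- exp (- b * 1\<^sup>2) / (2 * b) - - exp (- b * 0\<^sup>2) / (2 * b) \<le> 1 / (2 * b)"
    using assms by simp
  ultimately show ?thesis by (simp only: integral_unique)
qed

lemma gaussian_third_moment_le:
  fixes b :: real
  assumes "b > 0"
  shows "integral {0..1} (\<lambda>t. t ^ 3 * exp (- b * t\<^sup>2)) \<le> 1 / (2 * b\<^sup>2)"
proof -
  define k where "k = 1 / (2 * b)"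
  define l where "l = 1 / (2 * b\<^sup>2)"
  have kl: "2 * b * k = 1" "b * l = k" "k > 0" "l > 0"
    using assms by (simp_all add: k_def l_def power2_eq_square)
  define F where "F t = - (t\<^sup>2 * k + l) * exp (- b * t\<^sup>2)" for t
  have "(F has_real_derivative t ^ 3 * exp (- b * t\<^sup>2)) (at t within {0..1})" for t
  proof -
    have "(F has_real_derivative - (2 * t * k) * exp (- b * t\<^sup>2) +
        exp (- b * t\<^sup>2) * (- b * (2 * t)) * - (t\<^sup>2 * k + l)) (at t within {0..1})"
      unfolding F_def by (rule derivative_eq_intros refl)+ simp
    also have "- (2 * t * k) * e + e * (- b * (2 * t)) * - (t\<^sup>2 * k + l) = t ^ 3 * e" for e
      using kl(1,2) by algebra
    finally show ?thesis .
  qed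
  then have "((\<lambda>t. t ^ 3 * exp (- b * t\<^sup>2)) has_integral F 1 - F 0) {0..1}"
    by (intro fundamental_theorem_of_calculus) (auto simp flip: has_real_derivative_iff_has_vector_derivative)
  moreover have "F 1 \<le> 0" "F 0 = - l"
    using kl(3,4) by (auto simp: F_def intro!: mult_nonpos_nonneg)
  ultimately show ?thesis by (simp add: integral_unique l_def)
qed

text \<open>Rescaling to the unit disc keeps the factor \<open>r ^ (N - 1)\<close>. With r = exp(- a
  t^2) the error between the powers then still has Gaussian decay.\<close>

lemma norm_power_diff_le:
  fixes z w :: complex
  assumes "norm z \<le> r" "norm w \<le> r" "r > 0" "N \<ge> 1"
  shows "norm (z ^ N - w ^ N) \<le> N * norm (z - w) * r ^ (N - 1)"
proof -
  have r: "r ^ N = r * r ^ (N - 1)" using assms(4) by (cases N) auto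
  have "norm (z ^ N - w ^ N) = r ^ N * norm ((z / r) ^ N - (w / r) ^ N)"
    using assms by (simp add: power_divide norm_divide norm_power flip: diff_divide_distrib)
  also have "norm ((z / r) ^ N - (w / r) ^ N) \<le> N * norm (z / r - w / r)"
    using assms by (intro norm_power_diff) (auto simp: norm_divide)
  also have "norm (z / r - w / r) = norm (z - w) / r"
    using assms by (simp add: norm_divide flip: diff_divide_distrib)
  finally show ?thesis
    using assms(3) r by (simp add: mult_left_mono ac_simps)
qed

section \<open>Local bounds for sums of i.i.d. variables\<close>

locale iid_centred =
  fixes p X :: "'y::finite \<Rightarrow> real"
  assumes p_nonneg: "0 \<le> p y" and p_sum: "(\<Sum>y\<in>UNIV. p y) = 1"
    and mean_zero: "(\<Sum>y\<in>UNIV. p y * X y) = 0"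
    and nondegenerate: "\<exists>y. p y * X y \<noteq> 0"
begin

abbreviation P :: "'y list \<Rightarrow> real" where "P ys \<equiv> prod_list (map p ys)"
abbreviation S :: "'y list \<Rightarrow> real" where "S ys \<equiv> sum_list (map X ys)"

lemma P_nonneg: "0 \<le> P ys"
  by (rule prod_list_map_nonneg) (rule p_nonneg)

definition char_fun :: "real \<Rightarrow> complex" where
  "char_fun t = (\<Sum>y\<in>UNIV. of_real (p y) * cis (t * X y))"

lemma char_fun_power: "(\<Sum>ys\<in>outseqs N. of_real (P ys) * cis (t * S ys)) = char_fun t ^ N"
proof -
  have "of_real (P ys) * cis (t * S ys) = prod_list (map (\<lambda>y. of_real (p y) * cis (t * X y)) ys)" for ys
    by (induction ys) (simp_all add: distrib_left flip: cis_mult)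
  then show ?thesis
    by (simp add: char_fun_def sum_outseqs_prod_list)
qed

lemma continuous_char_fun [continuous_intros]:
  "continuous_on A f \<Longrightarrow> continuous_on A (\<lambda>t. char_fun (f t))"
  unfolding char_fun_def by (intro continuous_intros)

lemma variance_pos: "0 < (\<Sum>y\<in>UNIV. p y * (X y)\<^sup>2)"
proof -
  obtain y where "p y * X y \<noteq> 0" using nondegenerate by blast
  then have "0 < p y * (X y)\<^sup>2" using p_nonneg[of y] by (simp add: less_le)
  then show ?thesis using p_nonneg by (intro sum_pos2[of _ y]) auto
qed

text \<open>The linear term of the expansion vanishes because the variable is centred. The
  denominator 2 in the remainder is the \<open>fact n\<close> of \<open>Taylor_exp\<close>.\<close>

lemma char_fun_taylor:
  assumes "u \<ge> 0"
  shows "norm (char_fun u - of_real (1 - (\<Sum>y\<in>UNIV. p y * (X y)\<^sup>2) * u\<^sup>2 / 2))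
    \<le> (\<Sum>y\<in>UNIV. p y * \<bar>X y\<bar> ^ 3) * u ^ 3 / 2"
proof -
  have cis: "norm (cis a - (1 + \<i> * of_real a - (of_real a)\<^sup>2 / 2)) \<le> \<bar>a\<bar> ^ 3 / 2" for a :: real
  proof -
    have e2: "(\<Sum>k\<le>2. z ^ k / fact k) = 1 + z + z\<^sup>2 / 2" for z :: complex
      by (simp add: eval_nat_numeral atMost_Suc)
    have "(\<Sum>k\<le>2. (\<i> * a) ^ k / fact k) = 1 + \<i> * of_real a - (of_real a)\<^sup>2 / 2"
      unfolding e2 by (simp add: power_mult_distrib)
    then show ?thesis
      using Taylor_exp[of "\<i> * a" 2] by (simp add: cis_conv_exp norm_mult eval_nat_numeral)
  qed
  have "(\<Sum>y\<in>UNIV. of_real (p y) * (1 + \<i> * of_real (u * X y) - (of_real (u * X y))\<^sup>2 / 2)) =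
      of_real (\<Sum>y\<in>UNIV. p y) + \<i> * of_real (u * (\<Sum>y\<in>UNIV. p y * X y))
        - of_real ((\<Sum>y\<in>UNIV. p y * (X y)\<^sup>2) * u\<^sup>2 / 2)"
  proof -
    have "of_real (p y) * (1 + \<i> * of_real (u * X y) - (of_real (u * X y))\<^sup>2 / 2) =
        (of_real (p y) + \<i> * of_real (u * (p y * X y)) - of_real ((p y * (X y)\<^sup>2) * u\<^sup>2 / 2) :: complex)" for y
      by (simp add: algebra_simps power2_eq_square)
    then show ?thesis
      by (simp only: sum.distrib sum_subtractf of_real_sum sum_distrib_left sum_distrib_right sum_divide_distrib)
  qed
  then have "char_fun u - of_real (1 - (\<Sum>y\<in>UNIV. p y * (X y)\<^sup>2) * u\<^sup>2 / 2) =
      (\<Sum>y\<in>UNIV. of_real (p y) * (cis (u * X y) - (1 + \<i> * of_real (u * X y) - (of_real (u * X y))\<^sup>2 / 2)))"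
    by (simp add: p_sum mean_zero char_fun_def right_diff_distrib sum_subtractf)
  also have "norm \<dots> \<le> (\<Sum>y\<in>UNIV. p y * (\<bar>u * X y\<bar> ^ 3 / 2))"
    by (intro sum_norm_le) (simp only: norm_mult norm_of_real abs_of_nonneg[OF p_nonneg] cis p_nonneg mult_left_mono)
  also have "\<dots> = (\<Sum>y\<in>UNIV. p y * \<bar>X y\<bar> ^ 3) * u ^ 3 / 2"
    using assms unfolding sum_distrib_right sum_divide_distrib
    by (intro sum.cong refl) (simp add: abs_mult power_mult_distrib)
  finally show ?thesis .
qed

text \<open>Two bounds on the same small interval: a crude Gaussian domination for the upper
  estimate, and a cubic approximation error for the lower one. The domination has exponent a while
  the approximating Gaussian has 2 a; the difference absorbs the Taylor remainder.\<close>

lemma char_fun_gaussian: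
  obtains s a C where "s > 0" "a > 0" "C \<ge> 0"
    "\<And>t. t \<in> {0..1} \<Longrightarrow> norm (char_fun (s * t)) \<le> exp (- a * t\<^sup>2)"
    "\<And>t. t \<in> {0..1} \<Longrightarrow> norm (char_fun (s * t) - of_real (exp (- 2 * a * t\<^sup>2))) \<le> C * t ^ 3"
proof -
  define v where "v = (\<Sum>y\<in>UNIV. p y * (X y)\<^sup>2)"
  define m where "m = (\<Sum>y\<in>UNIV. p y * \<bar>X y\<bar> ^ 3)"
  have v: "v > 0" using variance_pos by (simp add: v_def)
  have m: "m \<ge> 0" unfolding m_def by (intro sum_nonneg mult_nonneg_nonneg p_nonneg) auto
  \<comment> \<open>The bound 1 / v keeps the quadratic approximation 1 - 2 a t^2 nonnegative. The
    bound v / (2 (m + 1)) makes the cubic remainder at most a t^2, half of the quadratic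
    term.\<close>
  define s where "s = min 1 (min (1 / v) (v / (2 * (m + 1))))"
  have s: "s > 0" "s \<le> 1" "v * s \<le> 1" "2 * (m * s) \<le> v"
  proof -
    show "s > 0" "s \<le> 1" using v m by (auto simp: s_def)
    have "v * s \<le> v * (1 / v)" unfolding s_def using v by (intro mult_left_mono) auto
    then show "v * s \<le> 1" using v by simp
    have "m * s \<le> (m + 1) * s" using \<open>s > 0\<close> by simp
    also have "\<dots> \<le> (m + 1) * (v / (2 * (m + 1)))"
      unfolding s_def using m by (intro mult_left_mono) auto
    also have "\<dots> = v / 2" using m by (simp add: divide_simps)
    finally show "2 * (m * s) \<le> v" by simp
  qed
  define a where "a = v * s\<^sup>2 / 4"
  \<comment> \<open>The first summand is the Taylor remainder; the second comes from |exp(- w) - (1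
    - w)| \<le> w^2 with w = 2 a t^2 and t^4 \<le> t^3.\<close>
  define C where "C = m * s ^ 3 / 2 + 4 * a\<^sup>2"
  have taylor: "norm (char_fun (s * t) - of_real (1 - 2 * a * t\<^sup>2)) \<le> m * s ^ 3 / 2 * t ^ 3"
    if "t \<in> {0..1}" for t
    using char_fun_taylor[of "s * t"] that s
    by (simp add: v_def[symmetric] m_def[symmetric] a_def power_mult_distrib ac_simps)
  have vs: "v * s\<^sup>2 \<le> 1"
    using mult_mono[OF s(3) s(2)] s v by (simp add: power2_eq_square)
  have "norm (char_fun (s * t)) \<le> exp (- a * t\<^sup>2)" if t: "t \<in> {0..1}" for t
  proof -
    have "t\<^sup>2 \<le> 1" using t by (simp add: power_le_one)
    then have le1: "2 * a * t\<^sup>2 \<le> 1"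
      using mult_mono[of "v * s\<^sup>2" 1 "t\<^sup>2" 1] vs by (simp add: a_def)
    have "m * s ^ 3 / 2 * t ^ 3 = (2 * (m * s)) * (s\<^sup>2 / 4) * (t\<^sup>2 * t)"
      by (simp add: power2_eq_square power3_eq_cube)
    also have "\<dots> \<le> v * (s\<^sup>2 / 4) * (t\<^sup>2 * 1)"
      using s t v by (intro mult_mono mult_right_mono) auto
    finally have "m * s ^ 3 / 2 * t ^ 3 \<le> a * t\<^sup>2" by (simp add: a_def)
    moreover have "norm (char_fun (s * t)) \<le>
        norm (char_fun (s * t) - of_real (1 - 2 * a * t\<^sup>2)) + norm (of_real (1 - 2 * a * t\<^sup>2) :: complex)"
      by (subst add.commute) (rule norm_triangle_sub)
    moreover have "norm (of_real (1 - 2 * a * t\<^sup>2) :: complex) = 1 - 2 * a * t\<^sup>2"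
      using le1 by (simp only: norm_of_real)
    ultimately have "norm (char_fun (s * t)) \<le> 1 + (- a * t\<^sup>2)"
      using taylor[OF t] by linarith
    also have "\<dots> \<le> exp (- a * t\<^sup>2)" by (rule exp_ge_add_one_self)
    finally show ?thesis .
  qed
  moreover have "norm (char_fun (s * t) - of_real (exp (- 2 * a * t\<^sup>2))) \<le> C * t ^ 3"
    if t: "t \<in> {0..1}" for t
  proof -
    define w where "w = 2 * a * t\<^sup>2"
    have w: "w \<ge> 0" using v by (simp add: w_def a_def)
    have "exp (- w) \<le> 1 / (1 + w)"
      using exp_ge_add_one_self[of w] w by (simp add: exp_minus field_simps)
    also have "\<dots> \<le> 1 - w + w\<^sup>2"
      using w by (simp add: divide_le_eq) (simp add: algebra_simps power2_eq_square)
    finally have "\<bar>exp (- w) - (1 - w)\<bar> \<le> w\<^sup>2"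
      using exp_ge_add_one_self[of "- w"] by simp
    also have "\<dots> = 4 * a\<^sup>2 * (t ^ 3 * t)"
      by (simp add: w_def power2_eq_square power3_eq_cube)
    also have "\<dots> \<le> 4 * a\<^sup>2 * (t ^ 3 * 1)"
      using t by (intro mult_left_mono) auto
    finally have "norm (of_real (1 - w) - of_real (exp (- w)) :: complex) \<le> 4 * a\<^sup>2 * t ^ 3"
      by (simp only: norm_of_real abs_minus_commute flip: of_real_diff)
    moreover have "norm (char_fun (s * t) - of_real (exp (- w))) \<le>
        norm (char_fun (s * t) - of_real (1 - w)) + norm (of_real (1 - w) - of_real (exp (- w)) :: complex)"
      by (rule order_trans[OF _ norm_triangle_ineq]) simp
    ultimately show ?thesis
      using taylor[OF t] by (simp add: w_def C_def distrib_right)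
  qed
  moreover have "a > 0" "C \<ge> 0"
    using v s m by (auto simp: a_def C_def)
  ultimately show ?thesis using that s(1) by blast
qed

lemma sum_cosine_integral:
  assumes w: "continuous_on {0..1} w"
  shows "(\<Sum>ys\<in>outseqs N. P ys * integral {0..1} (\<lambda>t. w t * cos (t * (s * S ys + c)))) =
    integral {0..1} (\<lambda>t. w t * Re (cis (t * c) * char_fun (s * t) ^ N))"
proof -
  have "(\<Sum>ys\<in>outseqs N. P ys * integral {0..1} (\<lambda>t. w t * cos (t * (s * S ys + c)))) =
      integral {0..1} (\<lambda>t. \<Sum>ys\<in>outseqs N. P ys * (w t * cos (t * (s * S ys + c))))"
    by (subst integral_sum)
       (auto intro!: integrable_continuous_interval continuous_intros w)
  also have "(\<lambda>t. \<Sum>ys\<in>outseqs N. P ys * (w t * cos (t * (s * S ys + c)))) =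
      (\<lambda>t. w t * Re (cis (t * c) * char_fun (s * t) ^ N))"
  proof
    fix t
    have "cis (t * c) * char_fun (s * t) ^ N = (\<Sum>ys\<in>outseqs N. of_real (P ys) * cis (t * (s * S ys + c)))"
      by (simp add: sum_distrib_left distrib_left ac_simps flip: char_fun_power cis_mult)
    then show "(\<Sum>ys\<in>outseqs N. P ys * (w t * cos (t * (s * S ys + c)))) =
        w t * Re (cis (t * c) * char_fun (s * t) ^ N)"
      by (simp add: sum_distrib_left ac_simps)
  qed
  finally show ?thesis .
qed

text \<open>Majorising by the two Fejer transforms turns the sum into two integrals of the N-th
  power of the characteristic function over [0, s], each dominated by a Gaussian integral. Rescaling
  the sum by \<open>s\<close> replaces \<beta> by \<beta> / s.\<close>

lemma exp_abs_concentration: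
  assumes "\<beta> > 0"
  obtains C where "C > 0"
    "\<And>N. N \<ge> 1 \<Longrightarrow> (\<Sum>ys\<in>outseqs N. P ys * exp (- \<beta> * \<bar>S ys\<bar>)) \<le> C / sqrt N"
proof -
  obtain s a where s: "s > 0" "a > 0" and
    phi: "\<And>t. t \<in> {0..1} \<Longrightarrow> norm (char_fun (s * t)) \<le> exp (- a * t\<^sup>2)"
    using char_fun_gaussian by metis
  obtain C where C: "C > 0" and majorant: "\<And>x. exp (- (\<beta> / s) * \<bar>x\<bar>) \<le>
    C * integral {0..1} (\<lambda>t. (1 - t) * cos (t * x) + (1 - t) * cos (t * (x + pi)))"
    using exp_abs_le_fejer[of "\<beta> / s"] assms s by auto
  have "(\<Sum>ys\<in>outseqs N. P ys * exp (- \<beta> * \<bar>S ys\<bar>)) \<le> (C * pi / sqrt a) / sqrt N" if N: "N \<ge> 1" for N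
  proof -
    define F where "F c = integral {0..1} (\<lambda>t. (1 - t) * Re (cis (t * c) * char_fun (s * t) ^ N))" for c
    have F_le: "F c \<le> pi / (2 * sqrt (a * N))" for c
    proof -
      have "F c \<le> integral {0..1} (\<lambda>t. exp (- (a * N) * t\<^sup>2))"
        unfolding F_def
      proof (rule integral_le)
        fix t :: real assume t: "t \<in> {0..1}"
        have "Re (cis (t * c) * char_fun (s * t) ^ N) \<le> norm (char_fun (s * t)) ^ N"
          using complex_Re_le_cmod[of "cis (t * c) * char_fun (s * t) ^ N"] by (simp add: norm_mult norm_power)
        also have "\<dots> \<le> exp (- a * t\<^sup>2) ^ N"
          using phi[OF t] by (intro power_mono) auto
        also have "\<dots> = exp (- (a * N) * t\<^sup>2)"
          by (simp add: exp_of_nat_mult[symmetric] ac_simps)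
        finally have "(1 - t) * Re (cis (t * c) * char_fun (s * t) ^ N) \<le> (1 - t) * exp (- (a * N) * t\<^sup>2)"
          using t by (intro mult_left_mono) auto
        also have "\<dots> \<le> 1 * exp (- (a * N) * t\<^sup>2)"
          using t by (intro mult_right_mono) auto
        finally show "(1 - t) * Re (cis (t * c) * char_fun (s * t) ^ N) \<le> exp (- (a * N) * t\<^sup>2)"
          by simp
      qed (auto intro!: integrable_continuous_interval continuous_intros)
      also have "\<dots> \<le> pi / (2 * sqrt (a * N))"
        using s N by (intro gaussian_integral_le) auto
      finally show ?thesis .
    qed
    have "(\<Sum>ys\<in>outseqs N. P ys * exp (- \<beta> * \<bar>S ys\<bar>)) \<le>
      (\<Sum>ys\<in>outseqs N. P ys * (C * (integral {0..1} (\<lambda>t. (1 - t) * cos (t * (s * S ys + 0))) +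
        integral {0..1} (\<lambda>t. (1 - t) * cos (t * (s * S ys + pi))))))"
    proof (intro sum_mono mult_left_mono P_nonneg)
      fix ys
      have "integral {0..1} (\<lambda>t. (1 - t) * cos (t * (s * S ys)) + (1 - t) * cos (t * (s * S ys + pi))) =
        integral {0..1} (\<lambda>t. (1 - t) * cos (t * (s * S ys))) + integral {0..1} (\<lambda>t. (1 - t) * cos (t * (s * S ys + pi)))"
        by (intro Henstock_Kurzweil_Integration.integral_add integrable_continuous_interval continuous_intros)
      then show "exp (- \<beta> * \<bar>S ys\<bar>) \<le> C * (integral {0..1} (\<lambda>t. (1 - t) * cos (t * (s * S ys + 0))) +
        integral {0..1} (\<lambda>t. (1 - t) * cos (t * (s * S ys + pi))))"
        using majorant[of "s * S ys"] s by (simp add: abs_mult)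
    qed
    also have "\<dots> = C * (F 0 + F pi)"
      unfolding F_def by (subst (1 2) sum_cosine_integral[symmetric])
        (auto intro!: continuous_intros simp: sum.distrib[symmetric] sum_distrib_left distrib_left ac_simps)
    also have "\<dots> \<le> C * (pi / (2 * sqrt (a * N)) + pi / (2 * sqrt (a * N)))"
      using C by (intro mult_left_mono add_mono F_le) auto
    also have "\<dots> = (C * pi / sqrt a) / sqrt N"
      by (simp add: real_sqrt_mult)
    finally show ?thesis .
  qed
  moreover have "C * pi / sqrt a > 0" using C s by simp
  ultimately show ?thesis using that by blast
qed

text \<open>The minorant is at most twice the indicator of the window. Its kernel equals 1 at t = 0,
  so its integral against the characteristic function keeps a positive Gaussian main term. The
  window stops at -1 rather than 0 so that the converse can use it at a threshold one below
  NR.\<close>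

lemma window_lower_bound:
  obtains c L N0 where "c > 0" "L > 0"
    "\<And>N. N \<ge> N0 \<Longrightarrow> c / sqrt N \<le> (\<Sum>ys\<in>{ys\<in>outseqs N. - L \<le> S ys \<and> S ys \<le> - 1}. P ys)"
proof -
  obtain s a C where s: "s > 0" "a > 0" "C \<ge> 0" and
    phi: "\<And>t. t \<in> {0..1} \<Longrightarrow> norm (char_fun (s * t)) \<le> exp (- a * t\<^sup>2)"
      "\<And>t. t \<in> {0..1} \<Longrightarrow> norm (char_fun (s * t) - of_real (exp (- 2 * a * t\<^sup>2))) \<le> C * t ^ 3"
    using char_fun_gaussian by metis
  \<comment> \<open>The shift d and the length L are solved from: |s x + d| \<le> 2 pi if and only
    if - L \<le> x \<le> - 1.\<close>
  define d where "d = 2 * pi + s"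
  define L where "L = (4 * pi + s) / s"
  define k where "k = minorant_kernel"
  have L: "L > 0" using s pi_gt_zero by (simp add: L_def add_pos_pos)
  \<comment> \<open>B / N is the total error from the two moment integrals. For N \<ge> N0 it takes
    at most half of the main term exp(- 2 a) / sqrt N; the factor 2 of the minorant costs another
    half, hence the 4 in c.\<close>
  define B where "B = (2 + 2 * d) / (4 * a) + 2 * C * exp a / (2 * a\<^sup>2)"
  define N0 where "N0 = nat \<lceil>(2 * B * exp (2 * a))\<^sup>2\<rceil> + 1"
  define c where "c = exp (- 2 * a) / 4"
  have window: "integral {0..1} (\<lambda>t. k t * cos (t * (s * x + d))) \<le> 2 * indicator {- L .. - 1} x" for x
  proof (cases "x \<in> {- L .. - 1}")
    case True
    then show ?thesis using abs_integral_minorant_le[of "s * x + d"] by (simp add: k_def)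
  next
    case False
    have "\<bar>s * x + d\<bar> > 2 * pi"
    proof (rule ccontr)
      assume "\<not> \<bar>s * x + d\<bar> > 2 * pi"
      then have "s * x \<le> s * - 1" "s * - L \<le> s * x" using s by (auto simp: d_def L_def)
      then show False using False s by (simp only: mult_le_cancel_left_pos) simp
    qed
    then show ?thesis using minorant_integral_nonpos False by (simp add: k_def)
  qed
  have "c / sqrt N \<le> (\<Sum>ys\<in>{ys\<in>outseqs N. - L \<le> S ys \<and> S ys \<le> - 1}. P ys)" if N0: "N \<ge> N0" for N
  proof -
    have N: "N \<ge> 1" using N0 by (simp add: N0_def)
    have lower: "exp (- (2 * a) * N * t\<^sup>2) - (2 + 2 * d) * (t * exp (- (2 * a * N) * t\<^sup>2))
        - 2 * (N * C * exp a) * (t ^ 3 * exp (- (a * N) * t\<^sup>2))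
      \<le> k t * Re (cis (t * d) * char_fun (s * t) ^ N)" if t: "t \<in> {0..1}" for t
    proof -
      define g where "g = exp (- 2 * a * t\<^sup>2)"
      define G where "G = exp (- (2 * a * N) * t\<^sup>2)"
      have gG: "g ^ N = G"
        by (simp add: g_def G_def exp_of_nat_mult[symmetric] ac_simps)
      have "norm (char_fun (s * t) ^ N - of_real g ^ N) \<le>
          N * norm (char_fun (s * t) - of_real g) * exp (- a * t\<^sup>2) ^ (N - 1)"
        using phi(1)[OF t] s N by (intro norm_power_diff_le) (auto simp: g_def)
      also have "\<dots> \<le> N * (C * t ^ 3) * (exp a * exp (- (a * N) * t\<^sup>2))"
      proof (intro mult_mono mult_left_mono)
        \<comment> \<open>Having the power N - 1 instead of N costs exp(a t^2) \<le> exp a.\<close>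
        have "exp (- a * t\<^sup>2) ^ (N - 1) = exp (a * t\<^sup>2) * exp (- (a * N) * t\<^sup>2)"
          using N by (simp add: exp_of_nat_mult[symmetric] exp_add[symmetric] algebra_simps of_nat_diff)
        also have "\<dots> \<le> exp a * exp (- (a * N) * t\<^sup>2)"
          using s t by (intro mult_right_mono) (auto simp: power_le_one)
        finally show "exp (- a * t\<^sup>2) ^ (N - 1) \<le> exp a * exp (- (a * N) * t\<^sup>2)" .
        show "norm (char_fun (s * t) - of_real g) \<le> C * t ^ 3"
          using phi(2)[OF t] by (simp add: g_def)
      qed (use s t in auto)
      finally have diff: "norm (char_fun (s * t) ^ N - of_real G) \<le>
          N * C * exp a * (t ^ 3 * exp (- (a * N) * t\<^sup>2))"
        by (simp add: gG ac_simps flip: of_real_power)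
      have "\<bar>k t\<bar> * \<bar>Re (cis (t * d) * (char_fun (s * t) ^ N - of_real G))\<bar> \<le>
          2 * (N * C * exp a * (t ^ 3 * exp (- (a * N) * t\<^sup>2)))"
        using abs_Re_le_cmod[of "cis (t * d) * (char_fun (s * t) ^ N - of_real G)"] diff
          abs_minorant_kernel_le[OF t] by (intro mult_mono) (auto simp: norm_mult k_def)
      moreover have "- (\<bar>k t\<bar> * \<bar>Re (cis (t * d) * (char_fun (s * t) ^ N - of_real G))\<bar>) \<le>
          k t * Re (cis (t * d) * (char_fun (s * t) ^ N - of_real G))"
        by (metis abs_ge_minus_self abs_mult minus_le_iff)
      \<comment> \<open>The slope 2 + 2 d combines the loss 2 t of the kernel below its value at 0
        with the loss 2 t d from the phase of the shifted window.\<close>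
      moreover have "(1 - (2 + 2 * d) * t) * G \<le> k t * cos (t * d) * G"
      proof (rule mult_right_mono)
        have "1 - cos (t * d) = 2 * (sin (t * d / 2))\<^sup>2"
          using cos_double_sin[of "t * d / 2"] by simp
        also have "\<dots> \<le> 2 * \<bar>sin (t * d / 2)\<bar>"
          using mult_left_mono[OF abs_sin_le_one, of "\<bar>sin (t * d / 2)\<bar>" "t * d / 2"]
          by (simp add: power2_eq_square flip: abs_mult)
        also have "\<dots> \<le> 2 * \<bar>t * d / 2\<bar>"
          by (intro mult_left_mono abs_sin_x_le_abs_x) simp
        finally have cos: "1 - cos (t * d) \<le> t * d"
          using s t pi_gt_zero by (simp add: d_def abs_mult)
        have "k t * (1 - cos (t * d)) \<le> 2 * (t * d)"
          using cos t abs_minorant_kernel_le[OF t] s pi_gt_zero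
          by (intro mult_mono) (auto simp: k_def d_def)
        moreover have "k t \<ge> 1 - 2 * t"
        proof -
          have "\<bar>sin (2 * pi * t)\<bar> \<le> 2 * pi * t"
            using abs_sin_x_le_abs_x[of "2 * pi * t"] t by (simp add: abs_mult)
          then have "- (2 * pi * t) / (2 * pi) \<le> sin (2 * pi * t) / (2 * pi)"
            by (intro divide_right_mono) auto
          then show ?thesis by (simp add: k_def minorant_kernel_def)
        qed
        ultimately show "1 - (2 + 2 * d) * t \<le> k t * cos (t * d)"
          by (simp add: algebra_simps)
      qed (simp add: G_def)
      moreover have "k t * Re (cis (t * d) * char_fun (s * t) ^ N) =
          k t * cos (t * d) * G + k t * Re (cis (t * d) * (char_fun (s * t) ^ N - of_real G))"
        by (simp add: algebra_simps)
      moreover have "(1 - (2 + 2 * d) * t) * G = exp (- (2 * a) * N * t\<^sup>2) - (2 + 2 * d) * (t * exp (- (2 * a * N) * t\<^sup>2))"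
        by (simp add: G_def algebra_simps)
      ultimately show ?thesis by linarith
    qed
    have "B * (2 * exp (2 * a)) \<le> sqrt N"
    proof (rule real_le_rsqrt)
      have "(2 * B * exp (2 * a))\<^sup>2 \<le> real N0" unfolding N0_def by linarith
      then show "(B * (2 * exp (2 * a)))\<^sup>2 \<le> N" using N0 by (simp add: ac_simps)
    qed
    then have "B \<le> exp (- 2 * a) / 2 * sqrt N"
      by (simp add: exp_minus field_simps)
    then have "B / N \<le> exp (- 2 * a) / 2 * sqrt N / N"
      by (intro divide_right_mono) auto
    also have "\<dots> = exp (- 2 * a) / 2 / sqrt N"
      using N by (simp add: field_simps flip: real_sqrt_mult)
    finally have "2 * (c / sqrt N) \<le> exp (- (2 * a)) / sqrt N - B / N"
      by (simp add: c_def)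
    also have "\<dots> \<le> integral {0..1} (\<lambda>t. exp (- (2 * a) * N * t\<^sup>2))
        - (2 + 2 * d) * integral {0..1} (\<lambda>t. t * exp (- (2 * a * N) * t\<^sup>2))
        - 2 * (N * C * exp a) * integral {0..1} (\<lambda>t. t ^ 3 * exp (- (a * N) * t\<^sup>2))"
    proof -
      have "(2 + 2 * d) * integral {0..1} (\<lambda>t. t * exp (- (2 * a * N) * t\<^sup>2)) \<le> (2 + 2 * d) * (1 / (2 * (2 * a * N)))"
        using s N pi_gt_zero by (intro mult_left_mono gaussian_first_moment_le) (auto simp: d_def)
      moreover have "2 * (N * C * exp a) * integral {0..1} (\<lambda>t. t ^ 3 * exp (- (a * N) * t\<^sup>2)) \<le>
          2 * (N * C * exp a) * (1 / (2 * (a * N)\<^sup>2))"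
        using s N by (intro mult_left_mono gaussian_third_moment_le) auto
      moreover have "B / N = (2 + 2 * d) * (1 / (2 * (2 * a * N))) + 2 * (N * C * exp a) * (1 / (2 * (a * N)\<^sup>2))"
        using N s by (simp add: B_def add_divide_distrib power2_eq_square)
      moreover have "exp (- (2 * a)) / sqrt N \<le> integral {0..1} (\<lambda>t. exp (- (2 * a) * N * t\<^sup>2))"
        using s N by (intro gaussian_integral_ge) auto
      ultimately show ?thesis by linarith
    qed
    also have "\<dots> = integral {0..1} (\<lambda>t. exp (- (2 * a) * N * t\<^sup>2) - (2 + 2 * d) * (t * exp (- (2 * a * N) * t\<^sup>2))
        - 2 * (N * C * exp a) * (t ^ 3 * exp (- (a * N) * t\<^sup>2)))"
      by (simp only: integral_mult_right[symmetric])
         (subst Henstock_Kurzweil_Integration.integral_diff[symmetric],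
           (intro integrable_continuous_interval continuous_intros)+, simp only:
          Henstock_Kurzweil_Integration.integral_diff[symmetric] integrable_continuous_interval continuous_intros)
    also have "\<dots> \<le> integral {0..1} (\<lambda>t. k t * Re (cis (t * d) * char_fun (s * t) ^ N))"
      using lower unfolding k_def by (intro integral_le integrable_continuous_interval continuous_intros) auto
    also have "\<dots> = (\<Sum>ys\<in>outseqs N. P ys * integral {0..1} (\<lambda>t. k t * cos (t * (s * S ys + d))))"
      unfolding k_def by (rule sum_cosine_integral[symmetric]) (rule continuous_minorant_kernel)
    also have "\<dots> \<le> (\<Sum>ys\<in>outseqs N. P ys * (2 * indicator {- L .. - 1} (S ys)))"
      by (intro sum_mono mult_left_mono window P_nonneg)
    also have "\<dots> = 2 * (\<Sum>ys\<in>{ys\<in>outseqs N. - L \<le> S ys \<and> S ys \<le> - 1}. P ys)"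
      by (simp add: indicator_def sum_distrib_left sum.inter_filter of_bool_def if_distrib ac_simps cong: if_cong)
    finally show ?thesis by simp
  qed
  moreover have "c > 0" by (simp add: c_def)
  ultimately show ?thesis using that L by blast
qed

end

section \<open>Symmetric singular channels and their exponents\<close>

text \<open>Concavity of ln with weights 1/a and 1 - 1/a at the points 1 + a (u - 1) and 1, whose
  weighted mean is u. If the left-hand side is not positive, or u = 0, nothing is left to
  show.\<close>

lemma bernoulli_powr:
  fixes u a :: real
  assumes "u \<ge> 0" "a \<ge> 1"
  shows "1 + a * (u - 1) \<le> u powr a"
proof (cases "1 + a * (u - 1) > 0 \<and> u > 0")
  case True
  have "ln (1 + a * (u - 1)) \<le> a * ln u"
  proof -
    have "ln (1 + a * (u - 1)) / a = ((1 / a) * ln (1 + a * (u - 1)) + (1 - 1 / a) * ln 1)"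
      by simp
    also have "\<dots> \<le> ln ((1 / a) * (1 + a * (u - 1)) + (1 - 1 / a) * 1)"
      using True assms concave_onD[OF ln_concave, of "1 - 1/a" "1 + a * (u - 1)" 1] by (simp add: divide_simps)
    also have "(1 / a) * (1 + a * (u - 1)) + (1 - 1 / a) * 1 = u"
      using assms by (simp add: field_simps)
    finally show ?thesis using assms by (simp add: field_simps)
  qed
  then have "exp (ln (1 + a * (u - 1))) \<le> exp (a * ln u)" by simp
  then show ?thesis using True by (simp add: powr_def)
next
  case False
  then have "1 + a * (u - 1) \<le> 0" using assms by (cases "u = 0") auto
  then show ?thesis by (rule order_trans) simp
qed

locale singular_symmetric_channel =
  fixes W :: "'x::finite \<Rightarrow> 'y::finite \<Rightarrow> real"
  assumes channel: "is_channel W" and symmetric: "symmetric_channel W" and singular: "singular_channel W"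
begin

definition frac :: "'y \<Rightarrow> real" where
  "frac y = real (card {x. W x y > 0}) / real CARD('x)"

text \<open>Since ln 0 = 0, an output that no input reaches gets the value 0; such outputs have
  \<open>q y = 0\<close>.\<close>

definition z :: "'y \<Rightarrow> real" where
  "z y = - ln (frac y)"

definition q :: "'y \<Rightarrow> real" where
  "q y = (\<Sum>x\<in>UNIV. W x y) / real CARD('x)"

lemma W_nonneg: "0 \<le> W x y" and W_sum: "(\<Sum>y\<in>UNIV. W x y) = 1"
  using channel by (simp_all add: is_channel_def)

lemma W_le_0_iff: "W x y \<le> 0 \<longleftrightarrow> W x y = 0"
  using W_nonneg[of x y] by linarith

lemma q_nonneg: "0 \<le> q y"
  unfolding q_def by (intro divide_nonneg_nonneg sum_nonneg W_nonneg) auto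

lemma q_sum: "(\<Sum>y\<in>UNIV. q y) = 1"
  unfolding q_def sum_divide_distrib[symmetric]
  by (subst sum.swap) (simp add: W_sum)

lemma frac_le_1: "frac y \<le> 1"
  using card_mono[of UNIV "{x. W x y > 0}"] by (simp add: frac_def)

lemma z_nonneg: "0 \<le> z y"
proof -
  have "frac y \<ge> 0" by (simp add: frac_def)
  then show ?thesis using frac_le_1[of y] by (cases "frac y = 0") (auto simp: z_def ln_le_zero_iff)
qed

lemma frac_pos: "W x y > 0 \<Longrightarrow> 0 < frac y"
  by (auto simp: frac_def card_gt_0_iff intro!: divide_pos_pos)

text \<open>By singularity the column sum is the number of compatible inputs times their common
  likelihood.\<close>

lemma q_eq_W_frac: "W x y > 0 \<Longrightarrow> q y = W x y * frac y"
proof -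
  assume W: "W x y > 0"
  have "(\<Sum>x'\<in>UNIV. W x' y) = (\<Sum>x'\<in>{x'. W x' y > 0}. W x y)"
    by (rule sum.mono_neutral_cong_right)
       (use singular W in \<open>auto simp: singular_channel_def W_le_0_iff not_less\<close>)
  then show ?thesis by (simp add: q_def frac_def)
qed

lemma q_pos_iff: "q y > 0 \<longleftrightarrow> (\<exists>x. W x y > 0)"
proof
  assume "q y > 0"
  then have "(\<Sum>x\<in>UNIV. W x y) \<noteq> 0" by (auto simp: q_def)
  then show "\<exists>x. W x y > 0" by (metis W_nonneg less_le sum.neutral)
next
  assume "\<exists>x. W x y > 0"
  then show "q y > 0" using q_eq_W_frac frac_pos by auto
qed

lemma exp_z: "W x y > 0 \<Longrightarrow> exp (- z y) = frac y"
  using frac_pos by (simp add: z_def)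

lemma W_eq: "W x y > 0 \<Longrightarrow> W x y = q y * exp (z y)"
  using q_eq_W_frac[of x y] exp_z[of x y] frac_pos[of x y] by (simp add: exp_minus field_simps)

lemma W_le: "W x y \<le> q y * exp (z y)"
  using W_eq[of x y] q_nonneg[of y] W_nonneg[of x y] by (cases "W x y > 0") (auto simp: W_le_0_iff not_less)

text \<open>In a block of the symmetry partition the column permutations make \<open>z\<close>
  constant, and the row permutations give every input the same probability of the block. So the law
  of \<open>z\<close> does not depend on the input and agrees with its average under
  \<open>q\<close>.\<close>

lemma sum_W_z: "(\<Sum>y\<in>UNIV. W x y * F (z y)) = (\<Sum>y\<in>UNIV. q y * F (z y))"
proof -
  obtain P where P: "partition_on (UNIV :: 'y set) P"
    and sub: "\<forall>S\<in>P. (\<forall>x x'. \<exists>\<sigma>. bij_betw \<sigma> S S \<and> (\<forall>y\<in>S. W x' y = W x (\<sigma> y))) \<and>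
      (\<forall>y\<in>S. \<forall>y'\<in>S. \<exists>\<pi>. bij \<pi> \<and> (\<forall>x. W x y' = W (\<pi> x) y))"
    using symmetric unfolding symmetric_channel_def by (elim exE conjE)
  have rows: "\<exists>\<sigma>. bij_betw \<sigma> S S \<and> (\<forall>y\<in>S. W x' y = W x (\<sigma> y))" if "S \<in> P" for S x x'
    using bspec[OF sub that] by iprover
  have cols: "\<exists>\<pi>. bij \<pi> \<and> (\<forall>x. W x y' = W (\<pi> x) y)" if "S \<in> P" "y \<in> S" "y' \<in> S" for S y y'
    using bspec[OF sub that(1)] that(2,3) by (elim conjE) (drule (1) bspec)+
  have row_sum: "(\<Sum>y\<in>S. W x' y) = (\<Sum>y\<in>S. W x y)" if "S \<in> P" for S x x'
  proof -
    obtain \<sigma> where "bij_betw \<sigma> S S" "\<forall>y\<in>S. W x' y = W x (\<sigma> y)" using rows \<open>S \<in> P\<close> by blast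
    then show ?thesis using sum.reindex_bij_betw[of \<sigma> S S "W x"] by simp
  qed
  have z_const: "z y' = z y" if S: "S \<in> P" "y \<in> S" "y' \<in> S" for S y y'
  proof -
    obtain \<pi> where \<pi>: "bij \<pi>" "\<And>x. W x y' = W (\<pi> x) y" using cols[OF S] by blast
    have "\<pi> ` {x. W x y' > 0} = {x. W x y > 0}"
      using \<pi>(2) bij_is_surj[OF \<pi>(1)] by (auto simp: surj_def image_iff)
    then have "card {x. W x y' > 0} = card {x. W x y > 0}"
      using card_image[OF inj_on_subset[OF bij_is_inj[OF \<pi>(1)]], of "{x. W x y' > 0}"] by simp
    then show ?thesis by (simp add: z_def frac_def)
  qed
  have split: "(\<Sum>y\<in>UNIV. f y) = (\<Sum>S\<in>P. \<Sum>y\<in>S. f y)" for f :: "'y \<Rightarrow> real"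
    using sum.Union_disjoint_sets[of P f] P by (simp add: partition_on_def)
  have "(\<Sum>y\<in>S. W x' y * F (z y)) = (\<Sum>y\<in>S. W x y * F (z y))" if S: "S \<in> P" for S x x'
  proof -
    have "S \<noteq> {}" using P S by (auto simp: partition_on_def)
    then obtain y0 where y0: "y0 \<in> S" by blast
    have "(\<Sum>y\<in>S. W x'' y * F (z y)) = (\<Sum>y\<in>S. W x'' y) * F (z y0)" for x''
      unfolding sum_distrib_right by (intro sum.cong refl) (simp add: z_const[OF S y0])
    then show ?thesis by (simp only: row_sum[OF S, of x' x])
  qed
  then have inv: "(\<Sum>y\<in>UNIV. W x' y * F (z y)) = (\<Sum>y\<in>UNIV. W x y * F (z y))" for x'
    unfolding split by (rule sum.cong[OF refl])
  have "(\<Sum>y\<in>UNIV. q y * F (z y)) = (\<Sum>x'\<in>UNIV. \<Sum>y\<in>UNIV. W x' y * F (z y)) / CARD('x)"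
    by (subst sum.swap) (simp add: q_def sum_divide_distrib sum_distrib_right)
  also have "(\<Sum>x'\<in>UNIV. \<Sum>y\<in>UNIV. W x' y * F (z y)) = (\<Sum>x'\<in>(UNIV :: 'x set). \<Sum>y\<in>UNIV. W x y * F (z y))"
    by (rule sum.cong[OF refl inv])
  finally show ?thesis by simp
qed

text \<open>The moment generating function at \<open>- \<rho>\<close> of the information density \<open>z\<close>;
  Gallager's function at the uniform input is \<open>- ln\<close> of it.\<close>
definition mgf :: "real \<Rightarrow> real" where
  "mgf \<rho> = (\<Sum>y\<in>UNIV. q y * exp (- \<rho> * z y))"

definition mean :: real where
  "mean = (\<Sum>y\<in>UNIV. q y * z y)"

lemma ex_q_pos: "\<exists>y. q y > 0"
proof (rule ccontr)
  assume "\<not> (\<exists>y. q y > 0)"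
  then have "q y = 0" for y using q_nonneg[of y] by (metis less_le)
  then show False using q_sum by simp
qed

lemma mgf_pos: "mgf \<rho> > 0"
proof -
  obtain y where "q y > 0" using ex_q_pos by blast
  then show ?thesis
    unfolding mgf_def using q_nonneg by (intro sum_pos2[of _ y]) auto
qed

text \<open>With c the likelihood in column y and u the input mass compatible with y, the summand of
  Gallager's sum is c u^(1 + \<rho>). It lies above its tangent at u = \<open>frac y\<close>, the
  value for the uniform input. Summed over y the linear terms cancel, because by
  \<open>sum_W_z\<close> the mean of exp(- \<rho> z) is the same under every input law.\<close>

lemma E_o_le:
  assumes Q: "pdist Q" and \<rho>: "\<rho> \<ge> 0"
  shows "E_o W \<rho> Q \<le> - ln (mgf \<rho>)"
proof -
  have Q_nonneg: "0 \<le> Q x" and Q_sum: "(\<Sum>x\<in>UNIV. Q x) = 1" for x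
    using Q by (auto simp: pdist_def)
  define T where "T y = (\<Sum>x\<in>UNIV. Q x * W x y powr (1 / (1 + \<rho>))) powr (1 + \<rho>)" for y
  have T: "q y * exp (- \<rho> * z y) + (1 + \<rho>) * exp (- \<rho> * z y) * ((\<Sum>x\<in>UNIV. Q x * W x y) - q y) \<le> T y" for y
  proof (cases "\<exists>x. W x y > 0")
    case False
    then have "W x y = 0" for x using W_nonneg[of x y] by (metis less_le)
    then show ?thesis by (simp add: T_def q_def)
  next
    case True
    then obtain x0 where x0: "W x0 y > 0" by blast
    define c where "c = W x0 y"
    define A where "A = {x. W x y > 0}"
    define u where "u = (\<Sum>x\<in>A. Q x)"
    define \<pi> where "\<pi> = frac y"
    have pos: "c > 0" "\<pi> > 0" "u \<ge> 0"
      using x0 frac_pos Q_nonneg by (auto simp: c_def \<pi>_def u_def intro: sum_nonneg)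
    have W: "W x y = (if x \<in> A then c else 0)" for x
      using singular x0 W_nonneg[of x y] unfolding singular_channel_def c_def A_def
      by (metis less_le mem_Collect_eq mult_pos_pos)
    have sumA: "(\<Sum>x\<in>UNIV. Q x * W x y) = c * u"
      by (simp add: W u_def sum_distrib_left if_distrib sum.If_cases mult.commute cong: if_cong)
    have "(\<Sum>x\<in>UNIV. Q x * W x y powr (1 / (1 + \<rho>))) = (\<Sum>x\<in>A. Q x * c powr (1 / (1 + \<rho>)))"
      by (rule sum.mono_neutral_cong_right) (auto simp: W)
    also have "\<dots> = c powr (1 / (1 + \<rho>)) * u"
      by (simp add: u_def mult.commute flip: sum_distrib_right)
    finally have "(\<Sum>x\<in>UNIV. Q x * W x y powr (1 / (1 + \<rho>))) = c powr (1 / (1 + \<rho>)) * u" .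
    then have "T y = c * u powr (1 + \<rho>)"
      using pos \<rho> by (simp add: T_def powr_mult powr_powr)
    moreover have "\<pi> powr (1 + \<rho>) * (1 + (1 + \<rho>) * (u / \<pi> - 1)) \<le> \<pi> powr (1 + \<rho>) * (u / \<pi>) powr (1 + \<rho>)"
      using pos \<rho> by (intro mult_left_mono bernoulli_powr) auto
    moreover have "\<pi> powr (1 + \<rho>) * (u / \<pi>) powr (1 + \<rho>) = u powr (1 + \<rho>)"
      using pos by (simp add: powr_divide)
    ultimately have "c * (\<pi> powr (1 + \<rho>) * (1 + (1 + \<rho>) * (u / \<pi> - 1))) \<le> T y"
      using pos by (simp add: mult_left_mono)
    moreover have e: "exp (- \<rho> * z y) = \<pi> powr \<rho>"
      using pos by (simp add: z_def \<pi>_def powr_def)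
    moreover have "q y = c * \<pi>" using q_eq_W_frac[OF x0] by (simp add: c_def \<pi>_def)
    moreover have "\<pi> powr (1 + \<rho>) = \<pi> * \<pi> powr \<rho>" using pos by (simp add: powr_add)
    moreover have "c * (\<pi> * r * (1 + (1 + \<rho>) * (w - 1))) = c * \<pi> * r + (1 + \<rho>) * r * (c * u - c * \<pi>)"
      if "\<pi> * w = u" for r w
      unfolding that[symmetric] by (simp add: algebra_simps)
    then have "c * (\<pi> * r * (1 + (1 + \<rho>) * (u / \<pi> - 1))) = c * \<pi> * r + (1 + \<rho>) * r * (c * u - c * \<pi>)" for r
      using pos by simp
    ultimately show ?thesis by (simp only: sumA)
  qed
  have "(\<Sum>y\<in>UNIV. exp (- \<rho> * z y) * (\<Sum>x\<in>UNIV. Q x * W x y)) = (\<Sum>x\<in>UNIV. Q x * (\<Sum>y\<in>UNIV. W x y * exp (- \<rho> * z y)))"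
    by (simp only: sum_distrib_left) (subst sum.swap, simp add: ac_simps)
  also have "\<dots> = mgf \<rho>"
    unfolding sum_W_z[where F = "\<lambda>u. exp (- \<rho> * u)"] mgf_def[symmetric]
    by (simp add: Q_sum flip: sum_distrib_right)
  finally have mgf_Q: "(\<Sum>y\<in>UNIV. exp (- \<rho> * z y) * (\<Sum>x\<in>UNIV. Q x * W x y)) = mgf \<rho>" .
  have "(\<Sum>y\<in>UNIV. q y * exp (- \<rho> * z y) + (1 + \<rho>) * exp (- \<rho> * z y) * ((\<Sum>x\<in>UNIV. Q x * W x y) - q y)) =
      (\<Sum>y\<in>UNIV. q y * exp (- \<rho> * z y)) + (1 + \<rho>) * ((\<Sum>y\<in>UNIV. exp (- \<rho> * z y) * (\<Sum>x\<in>UNIV. Q x * W x y))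
        - (\<Sum>y\<in>UNIV. q y * exp (- \<rho> * z y)))"
    unfolding sum.distrib[symmetric] sum_subtractf[symmetric] sum_distrib_left[of "1 + \<rho>"]
    by (intro sum.cong refl) (simp add: algebra_simps)
  also have "\<dots> = mgf \<rho>"
    unfolding mgf_Q mgf_def[symmetric] by simp
  finally have "(\<Sum>y\<in>UNIV. q y * exp (- \<rho> * z y) + (1 + \<rho>) * exp (- \<rho> * z y) * ((\<Sum>x\<in>UNIV. Q x * W x y) - q y)) = mgf \<rho>" .
  then have "mgf \<rho> \<le> (\<Sum>y\<in>UNIV. T y)"
    by (rule ord_eq_le_trans[OF sym]) (intro sum_mono T)
  then show ?thesis
    using mgf_pos[of \<rho>] by (simp add: E_o_def T_def)
qed

lemma bdd_above_E_r: "bdd_above {E_o W \<rho> Q - \<rho> * R | \<rho> Q. pdist Q \<and> 0 \<le> \<rho> \<and> \<rho> \<le> 1}"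
proof (rule bdd_aboveI)
  fix e assume "e \<in> {E_o W \<rho> Q - \<rho> * R | \<rho> Q. pdist Q \<and> 0 \<le> \<rho> \<and> \<rho> \<le> 1}"
  then obtain \<rho> Q where e: "e = E_o W \<rho> Q - \<rho> * R" "pdist Q" "0 \<le> \<rho>" "\<rho> \<le> 1" by blast
  have "mgf 1 \<le> mgf \<rho>"
    unfolding mgf_def using e z_nonneg q_nonneg
    by (intro sum_mono mult_left_mono) (auto simp: mult_left_le_one_le)
  then have "- ln (mgf \<rho>) \<le> - ln (mgf 1)" using mgf_pos by simp
  moreover have "- (\<rho> * R) \<le> \<bar>R\<bar>"
  proof -
    have "\<bar>\<rho> * R\<bar> \<le> 1 * \<bar>R\<bar>"
      unfolding abs_mult using e by (intro mult_right_mono) auto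
    then show ?thesis by linarith
  qed
  ultimately show "e \<le> - ln (mgf 1) + \<bar>R\<bar>"
    using E_o_le[OF e(2,3)] e(1) by simp
qed

lemma pdist_uniform: "pdist (\<lambda>_::'x. 1 / real CARD('x))"
  by (simp add: pdist_def)

lemma E_r_le:
  assumes "\<And>\<rho>. 0 \<le> \<rho> \<Longrightarrow> \<rho> \<le> 1 \<Longrightarrow> - ln (mgf \<rho>) - \<rho> * R \<le> B"
  shows "E_r W R \<le> B"
  unfolding E_r_def
proof (rule cSup_least)
  show "{E_o W \<rho> Q - \<rho> * R |\<rho> Q. pdist Q \<and> 0 \<le> \<rho> \<and> \<rho> \<le> 1} \<noteq> {}"
    using pdist_uniform by force
  fix e assume "e \<in> {E_o W \<rho> Q - \<rho> * R | \<rho> Q. pdist Q \<and> 0 \<le> \<rho> \<and> \<rho> \<le> 1}"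
  then obtain \<rho> Q where e: "e = E_o W \<rho> Q - \<rho> * R" "pdist Q" "0 \<le> \<rho>" "\<rho> \<le> 1" by blast
  then show "e \<le> B" using E_o_le[OF e(2,3)] assms[OF e(3,4)] by simp
qed

lemma E_r_nonneg: "0 \<le> E_r W R"
proof -
  have "E_o W 0 (\<lambda>_. 1 / real CARD('x)) = 0"
    using q_sum q_nonneg W_nonneg
    by (simp add: E_o_def q_def sum_nonneg flip: sum_divide_distrib)
  then show ?thesis
    unfolding E_r_def using pdist_uniform
    by (intro cSup_upper bdd_above_E_r) force
qed

text \<open>The logarithm splits into z plus ln(q / r), with r the output law. The mean of the
  second term is nonpositive by ln u \<le> u - 1, and the mean of z is the same for every input
  law.\<close>

lemma mutual_info_le_mean:
  assumes Q: "pdist Q"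
  shows "mutual_info Q W \<le> mean"
proof -
  have Q_nonneg: "0 \<le> Q x" and Q_sum: "(\<Sum>x\<in>UNIV. Q x) = 1" for x
    using Q by (auto simp: pdist_def)
  define r where "r y = out_dist Q W y" for y
  have r_nonneg: "0 \<le> r y" for y
    unfolding r_def out_dist_def by (intro sum_nonneg mult_nonneg_nonneg Q_nonneg W_nonneg)
  have le: "(if Q x * W x y = 0 then 0 else Q x * W x y * ln (W x y / out_dist Q W y))
      \<le> Q x * W x y * (z y + q y / r y - 1)" for x y
  proof (cases "Q x * W x y = 0")
    case False
    then have pos: "Q x > 0" "W x y > 0"
      using Q_nonneg[of x] W_nonneg[of x y] by (auto simp: less_le)
    have "0 < Q x * W x y" using pos by simp
    also have "\<dots> \<le> r y" unfolding r_def out_dist_def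
      by (rule member_le_sum) (auto intro: Q_nonneg W_nonneg mult_nonneg_nonneg)
    finally have r: "r y > 0" .
    have q: "q y > 0" using pos q_pos_iff by blast
    have "W x y / r y = exp (z y) * (q y / r y)" using W_eq[OF pos(2)] by simp
    also have "ln \<dots> = z y + ln (q y / r y)" using q r by (subst ln_mult) auto
    also have "\<dots> \<le> z y + (q y / r y - 1)" using ln_le_minus_one[of "q y / r y"] q r by simp
    finally have "ln (W x y / r y) \<le> z y + q y / r y - 1" by simp
    then show ?thesis using pos False by (simp add: r_def mult_left_mono)
  qed auto
  have "mutual_info Q W \<le> (\<Sum>x\<in>UNIV. \<Sum>y\<in>UNIV. Q x * W x y * (z y + q y / r y - 1))"
    unfolding mutual_info_def by (intro sum_mono le)
  also have "\<dots> = (\<Sum>y\<in>UNIV. r y * (z y + q y / r y - 1))"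
    by (subst sum.swap) (simp add: r_def out_dist_def sum_distrib_right)
  \<comment> \<open>Equality can fail where r vanishes, since there r (q / r) is 0 rather than
    q.\<close>
  also have "\<dots> \<le> (\<Sum>y\<in>UNIV. r y * z y + q y - r y)"
    using q_nonneg by (intro sum_mono) (auto simp: algebra_simps)
  also have "\<dots> = (\<Sum>y\<in>UNIV. r y * z y) + 1 - (\<Sum>y\<in>UNIV. r y)"
    by (simp add: sum.distrib sum_subtractf q_sum)
  also have "(\<Sum>y\<in>UNIV. r y) = (\<Sum>x\<in>UNIV. Q x * (\<Sum>y\<in>UNIV. W x y))"
    unfolding r_def out_dist_def by (subst sum.swap) (simp add: sum_distrib_left)
  also have "\<dots> = 1" by (simp add: W_sum Q_sum)
  also have "(\<Sum>y\<in>UNIV. r y * z y) = (\<Sum>x\<in>UNIV. Q x * (\<Sum>y\<in>UNIV. W x y * z y))"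
    unfolding r_def out_dist_def sum_distrib_right by (subst sum.swap) (simp add: sum_distrib_left ac_simps)
  also have "\<dots> = mean"
    using sum_W_z[where F = "\<lambda>u. u"] by (simp add: mean_def Q_sum flip: sum_distrib_right)
  finally show ?thesis by simp
qed

lemma capacity_le_mean: "capacity W \<le> mean"
  unfolding capacity_def using pdist_uniform
  by (intro cSUP_least) (auto intro: mutual_info_le_mean)

lemma kl_div_self: "kl_div P P = 0"
  by (auto simp: kl_div_def zero_ereal_def intro!: sum.neutral)

lemma E_SP_le_0:
  assumes "mean \<le> R"
  shows "E_SP W R \<le> 0"
  unfolding E_SP_def
proof (rule SUP_least)
  fix Q :: "'x \<Rightarrow> real" assume "Q \<in> {Q. pdist Q}"
  then have "W \<in> {V. is_channel V \<and> mutual_info Q V \<le> R}"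
    using channel mutual_info_le_mean assms order_trans by auto
  then have "(INF V\<in>{V. is_channel V \<and> mutual_info Q V \<le> R}. cond_div Q V W) \<le> cond_div Q W W"
    by (rule INF_lower)
  moreover have "cond_div Q W W = 0" by (simp add: cond_div_def kl_div_self)
  ultimately show "(INF V\<in>{V. is_channel V \<and> mutual_info Q V \<le> R}. cond_div Q V W) \<le> 0"
    by (simp only:)
qed

text \<open>The right-hand side minus the left equals 1 + \<rho> times a divergence plus another
  divergence. The first compares the joint law of input and output under V with the law having the
  same output marginal v and, given y, a uniform compatible input. The second compares v with the
  tilted output law proportional to q exp(- \<rho> z).\<close>

lemma gallager_le_divergence_plus_info:
  assumes V: "is_channel V" and ac: "\<And>x y. V x y > 0 \<Longrightarrow> W x y > 0" and \<rho>: "\<rho> \<ge> 0"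
  defines "n \<equiv> real CARD('x)"
  shows "- ln (mgf \<rho>) \<le>
    (\<Sum>x\<in>UNIV. 1 / n * (\<Sum>y\<in>UNIV. if V x y = 0 then 0 else V x y * ln (V x y / W x y)))
    + \<rho> * mutual_info (\<lambda>_. 1 / n) V"
proof -
  have V_nonneg: "0 \<le> V x y" and V_sum: "(\<Sum>y\<in>UNIV. V x y) = 1" for x y
    using V by (auto simp: is_channel_def)
  have n: "n > 0" by (simp add: n_def)
  define v where "v y = out_dist (\<lambda>_. 1 / n) V y" for y
  have v_eq: "v y = (\<Sum>x\<in>UNIV. V x y / n)" for y by (simp add: v_def out_dist_def)
  have v_nonneg: "0 \<le> v y" for y unfolding v_eq using V_nonneg n by (intro sum_nonneg) auto
  define G where "G = mgf \<rho>"
  have G: "G > 0" using mgf_pos by (simp add: G_def)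
  define t where "t x y = (if V x y = 0 then 0 else V x y / n * (ln (V x y / W x y) + \<rho> * ln (V x y / v y) + ln G))" for x y
  \<comment> \<open>The terms a and b are the lower bounds that ln u \<ge> 1 - 1/u gives for the
    summands of the two divergences; each has a nonnegative total.\<close>
  define a where "a x y = V x y / n - (if W x y > 0 then v y / (n * frac y) else 0)" for x y
  define b where "b x y = V x y / n - V x y / n / v y * (q y * exp (- \<rho> * z y) / G)" for x y
  have le: "(1 + \<rho>) * a x y + b x y \<le> t x y" for x y
  proof (cases "V x y = 0")
    case True
    have "a x y \<le> 0" using v_nonneg[of y] n by (auto simp: a_def True frac_def)
    then have "(1 + \<rho>) * a x y \<le> 0" using \<rho> by (intro mult_nonneg_nonpos) auto
    then show ?thesis using True by (simp add: t_def b_def)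
  next
    case False
    then have Vp: "V x y > 0" using V_nonneg[of x y] by linarith
    then have Wp: "W x y > 0" by (rule ac)
    have qp: "q y > 0" using Wp q_pos_iff by blast
    have fp: "frac y > 0" using Wp by (rule frac_pos)
    have "0 < V x y / n" using Vp n by simp
    also have "\<dots> \<le> v y" unfolding v_eq using V_nonneg n by (intro member_le_sum) auto
    finally have vp: "v y > 0" .
    have "1 - v y / (V x y * frac y) \<le> ln (V x y * frac y / v y)"
      using ln_le_minus_one[of "v y / (V x y * frac y)"] Vp vp fp by (simp add: ln_div ln_mult)
    then have "V x y / n * (1 - v y / (V x y * frac y)) \<le> V x y / n * ln (V x y * frac y / v y)"
      using Vp n by (intro mult_left_mono) auto
    moreover have "V x y / n * (1 - v y / (V x y * frac y)) = a x y"
      using Vp Wp n fp by (simp add: a_def field_simps)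
    ultimately have 1: "(1 + \<rho>) * a x y \<le> (1 + \<rho>) * (V x y / n * ln (V x y * frac y / v y))"
      using \<rho> by (intro mult_left_mono) auto
    define e where "e = q y * exp (- \<rho> * z y) / G"
    have e: "e > 0" using qp G by (simp add: e_def)
    have "1 - e / v y \<le> ln (v y / e)"
      using ln_le_minus_one[of "e / v y"] e vp by (simp add: ln_div)
    then have "V x y / n * (1 - e / v y) \<le> V x y / n * ln (v y / e)"
      using Vp n by (intro mult_left_mono) auto
    moreover have "V x y / n * (1 - e / v y) = b x y" by (simp add: b_def e_def right_diff_distrib)
    ultimately have 2: "b x y \<le> V x y / n * ln (v y / e)" by (simp only:)
    have "(1 + \<rho>) * (k * l) + k * m = k * ((1 + \<rho>) * l + m)" for k l m
      by (simp add: algebra_simps)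
    with add_mono[OF 1 2]
    have "(1 + \<rho>) * a x y + b x y \<le> V x y / n * ((1 + \<rho>) * ln (V x y * frac y / v y) + ln (v y / e))"
      by (simp only:)
    also have "ln (v y / e) = ln (v y) - ln (q y) + \<rho> * z y + ln G"
      using vp qp G by (simp add: e_def ln_div ln_mult)
    also have "(1 + \<rho>) * ln (V x y * frac y / v y) = (1 + \<rho>) * (ln (V x y) - z y - ln (v y))"
      using Vp vp fp by (simp add: ln_div ln_mult z_def)
    also have "(1 + \<rho>) * (ln (V x y) - z y - ln (v y)) + (ln (v y) - ln (q y) + \<rho> * z y + ln G) =
        ln (V x y / W x y) + \<rho> * ln (V x y / v y) + ln G"
      using Vp vp qp Wp by (simp add: W_eq[OF Wp] ln_div ln_mult algebra_simps)
    finally show ?thesis using False by (simp add: t_def)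
  qed
  have "0 \<le> (\<Sum>y\<in>UNIV. \<Sum>x\<in>UNIV. a x y)"
  proof -
    have "(\<Sum>x\<in>UNIV. if W x y > 0 then v y / (n * frac y) else 0) \<le> v y" for y
      using v_nonneg[of y] n by (cases "frac y = 0") (auto simp: sum.If_cases frac_def n_def)
    then have "0 \<le> (\<Sum>x\<in>UNIV. a x y)" for y
      by (simp add: a_def sum_subtractf v_eq[symmetric])
    then show ?thesis by (rule sum_nonneg)
  qed
  moreover have "0 \<le> (\<Sum>y\<in>UNIV. \<Sum>x\<in>UNIV. b x y)"
  proof -
    have "(\<Sum>x\<in>UNIV. b x y) = v y - v y / v y * (q y * exp (- \<rho> * z y) / G)" for y
      by (simp only: b_def sum_subtractf v_eq sum_distrib_right sum_divide_distrib)
    moreover have "v y / v y * (q y * exp (- \<rho> * z y) / G) \<le> 1 * (q y * exp (- \<rho> * z y) / G)" for y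
      using q_nonneg[of y] G by (intro mult_right_mono) auto
    ultimately have "(\<Sum>y\<in>UNIV. \<Sum>x\<in>UNIV. b x y) \<ge> (\<Sum>y\<in>UNIV. v y - q y * exp (- \<rho> * z y) / G)"
      by (intro sum_mono) (simp only: mult_1 diff_left_mono)
    moreover have "(\<Sum>y\<in>UNIV. v y) = 1"
      unfolding v_eq by (subst sum.swap) (use n in \<open>simp add: V_sum n_def flip: sum_divide_distrib\<close>)
    moreover have "(\<Sum>y\<in>UNIV. q y * exp (- \<rho> * z y) / G) = 1"
      using G by (simp add: G_def mgf_def flip: sum_divide_distrib)
    ultimately show ?thesis by (simp add: sum_subtractf)
  qed
  ultimately have "0 \<le> (1 + \<rho>) * (\<Sum>y\<in>UNIV. \<Sum>x\<in>UNIV. a x y) + (\<Sum>y\<in>UNIV. \<Sum>x\<in>UNIV. b x y)"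
    using \<rho> by simp
  also have "\<dots> = (\<Sum>y\<in>UNIV. \<Sum>x\<in>UNIV. (1 + \<rho>) * a x y + b x y)"
    by (simp only: sum.distrib sum_distrib_left)
  also have "\<dots> \<le> (\<Sum>y\<in>UNIV. \<Sum>x\<in>UNIV. t x y)"
    by (intro sum_mono le)
  also have "\<dots> = (\<Sum>x\<in>UNIV. \<Sum>y\<in>UNIV. t x y)"
    by (rule sum.swap)
  also have "\<dots> = (\<Sum>x\<in>UNIV. \<Sum>y\<in>UNIV. 1 / n * (if V x y = 0 then 0 else V x y * ln (V x y / W x y))
      + \<rho> * (if 1 / n * V x y = 0 then 0 else 1 / n * V x y * ln (V x y / v y)) + ln G * (V x y / n))"
    using n by (intro sum.cong refl) (auto simp: t_def algebra_simps add_divide_distrib)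
  also have "\<dots> = (\<Sum>x\<in>UNIV. 1 / n * (\<Sum>y\<in>UNIV. if V x y = 0 then 0 else V x y * ln (V x y / W x y)))
      + \<rho> * mutual_info (\<lambda>_. 1 / n) V + ln G * (\<Sum>x\<in>UNIV. (\<Sum>y\<in>UNIV. V x y) / n)"
    by (simp only: sum.distrib sum_distrib_left mutual_info_def v_def sum_divide_distrib)
  also have "(\<Sum>x\<in>UNIV. (\<Sum>y\<in>UNIV. V x y) / n) = 1"
    by (simp add: V_sum n_def)
  finally show ?thesis by (simp add: G_def)
qed

text \<open>Weak duality at the uniform input, which is one competitor in the supremum. An auxiliary
  channel that leaves the support of W has infinite divergence; for the others the rate constraint
  bounds the information term by \<rho> R.\<close>

lemma E_SP_ge:
  assumes \<rho>: "\<rho> \<ge> 0"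
  shows "ereal (- ln (mgf \<rho>) - \<rho> * R) \<le> E_SP W R"
proof -
  define U where "U = (\<lambda>_::'x. 1 / real CARD('x))"
  have "ereal (- ln (mgf \<rho>) - \<rho> * R) \<le> cond_div U V W"
    if V: "is_channel V" "mutual_info U V \<le> R" for V
  proof (cases "\<exists>x y. V x y > 0 \<and> W x y = 0")
    case True
    then obtain x where "\<exists>y. V x y > 0 \<and> W x y = 0" by blast
    then have "kl_div (V x) (W x) = \<infinity>" by (simp add: kl_div_def)
    then have "ereal (U x) * kl_div (V x) (W x) = \<infinity>" by (simp add: U_def)
    moreover have "\<bar>ereal (U x) * kl_div (V x) (W x)\<bar> \<noteq> \<infinity> \<or> ereal (U x) * kl_div (V x) (W x) = \<infinity>" for x
      by (auto simp: kl_div_def U_def)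
    ultimately have "cond_div U V W = \<infinity>"
      by (subst cond_div_def, subst sum_Pinfty) (auto simp: U_def)
    then show ?thesis by simp
  next
    case False
    then have ac: "V x y > 0 \<Longrightarrow> W x y > 0" for x y using W_nonneg[of x y] by (metis less_le)
    have "cond_div U V W = ereal (\<Sum>x\<in>UNIV. 1 / real CARD('x) * (\<Sum>y\<in>UNIV. if V x y = 0 then 0 else V x y * ln (V x y / W x y)))"
    proof -
      have "kl_div (V x) (W x) = ereal (\<Sum>y\<in>UNIV. if V x y = 0 then 0 else V x y * ln (V x y / W x y))" for x
        using False by (simp add: kl_div_def)
      then show ?thesis by (simp add: cond_div_def U_def)
    qed
    moreover have "\<rho> * mutual_info U V \<le> \<rho> * R" using V(2) \<rho> by (rule mult_left_mono)
    ultimately show ?thesis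
      using gallager_le_divergence_plus_info[OF V(1) ac \<rho>] by (simp add: U_def)
  qed
  then have "ereal (- ln (mgf \<rho>) - \<rho> * R) \<le> (INF V\<in>{V. is_channel V \<and> mutual_info U V \<le> R}. cond_div U V W)"
    by (intro INF_greatest) auto
  also have "\<dots> \<le> E_SP W R"
    unfolding E_SP_def by (rule SUP_upper) (use pdist_uniform in \<open>simp add: U_def\<close>)
  finally show ?thesis .
qed

end

section \<open>Coding bounds\<close>

context singular_symmetric_channel
begin

abbreviation Q :: "'y list \<Rightarrow> real" where "Q ys \<equiv> prod_list (map q ys)"
abbreviation Z :: "'y list \<Rightarrow> real" where "Z ys \<equiv> sum_list (map z ys)"

lemma Q_nonneg: "0 \<le> Q ys"
  by (rule prod_list_map_nonneg) (rule q_nonneg)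

text \<open>The inputs \<open>a i\<close> are arbitrary, so that they may be the letters of a
  codeword or the choices of a feedback encoder along \<open>ys\<close>.\<close>

lemma prod_W_le: "(\<Prod>i<length ys. W (a i) (ys ! i)) \<le> Q ys * exp (Z ys)"
  and prod_W_eq: "0 < (\<Prod>i<length ys. W (a i) (ys ! i)) \<Longrightarrow> (\<Prod>i<length ys. W (a i) (ys ! i)) = Q ys * exp (Z ys)"
proof -
  have eq: "Q ys * exp (Z ys) = (\<Prod>i<length ys. q (ys ! i) * exp (z (ys ! i)))"
    unfolding prod_list_exp[symmetric] prod_list_mult_map[symmetric]
    by (simp add: prod.list_conv_set_nth atLeast0LessThan)
  show "(\<Prod>i<length ys. W (a i) (ys ! i)) \<le> Q ys * exp (Z ys)"
    unfolding eq by (intro prod_mono) (auto intro: W_nonneg W_le)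
  assume pos: "0 < (\<Prod>i<length ys. W (a i) (ys ! i))"
  have "W (a i) (ys ! i) > 0" if "i < length ys" for i
  proof (rule ccontr)
    assume "\<not> W (a i) (ys ! i) > 0"
    then have "W (a i) (ys ! i) = 0" using W_nonneg[of "a i" "ys ! i"] by simp
    then have "(\<Prod>i<length ys. W (a i) (ys ! i)) = 0" using that by (intro prod_zero) auto
    then show False using pos by (simp only: less_irrefl)
  qed
  then show "(\<Prod>i<length ys. W (a i) (ys ! i)) = Q ys * exp (Z ys)"
    unfolding eq by (intro prod.cong) (auto intro: W_eq)
qed

lemma fb_prob_nonneg: "0 \<le> fb_prob W N enc m ys"
  unfolding fb_prob_def by (intro prod_nonneg) (auto intro: W_nonneg)

lemma fb_prob_le: "ys \<in> outseqs N \<Longrightarrow> fb_prob W N enc m ys \<le> Q ys * exp (Z ys)"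
  using prod_W_le[of "\<lambda>n. enc m (take n ys)" ys] by (simp add: fb_prob_def outseqs_def)

text \<open>The information densities are i.i.d. whatever the encoder does, even with feedback.\<close>
lemma sum_fb_prob:
  "(\<Sum>ys\<in>outseqs N. fb_prob W N enc m ys * F (map z ys)) = (\<Sum>ys\<in>outseqs N. Q ys * F (map z ys))"
proof (induction N arbitrary: F)
  case 0
  then show ?case by (simp add: fb_prob_def)
next
  case (Suc N)
  have "fb_prob W (Suc N) enc m (ys @ [y]) = fb_prob W N enc m ys * W (enc m ys) y" if "ys \<in> outseqs N" for ys y
    using that by (auto simp: fb_prob_def outseqs_def nth_append intro!: prod.cong)
  then have "(\<Sum>ys\<in>outseqs (Suc N). fb_prob W (Suc N) enc m ys * F (map z ys)) =
      (\<Sum>ys\<in>outseqs N. fb_prob W N enc m ys * (\<Sum>y\<in>UNIV. W (enc m ys) y * F (map z ys @ [z y])))"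
    by (simp add: sum_outseqs_Suc sum_distrib_left mult.assoc)
  also have "\<dots> = (\<Sum>ys\<in>outseqs N. fb_prob W N enc m ys * (\<Sum>y\<in>UNIV. q y * F (map z ys @ [z y])))"
    by (simp only: sum_W_z[where F = "\<lambda>u. F (map z ys @ [u])" for ys])
  also have "\<dots> = (\<Sum>ys\<in>outseqs N. Q ys * (\<Sum>y\<in>UNIV. q y * F (map z ys @ [z y])))"
    by (rule Suc.IH[of "\<lambda>zs. \<Sum>y\<in>UNIV. q y * F (zs @ [z y])"])
  also have "\<dots> = (\<Sum>ys\<in>outseqs (Suc N). Q ys * F (map z ys))"
    by (simp add: sum_outseqs_Suc sum_distrib_left mult.assoc)
  finally show ?case .
qed

lemma prod_chan_nonneg: "0 \<le> prod_chan W xs ys"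
  unfolding prod_chan_def by (intro prod_nonneg) (auto intro: W_nonneg)

text \<open>A codeword is a feedback encoder that uses only the number of past outputs.\<close>

lemma sum_prod_chan:
  "(\<Sum>ys\<in>outseqs N. prod_chan W xs ys * F (map z ys)) = (\<Sum>ys\<in>outseqs N. Q ys * F (map z ys))"
proof -
  have "prod_chan W xs ys = fb_prob W N (\<lambda>_ ys. xs ! length ys) 0 ys" if "ys \<in> outseqs N" for ys
    using that by (auto simp: prod_chan_def fb_prob_def outseqs_def intro!: prod.cong)
  then show ?thesis
    using sum_fb_prob[of N "\<lambda>_ ys. xs ! length ys" 0 F] by simp
qed

text \<open>A uniformly random input word produces the output law \<open>Q\<close>; this drives the
  choice of codewords by averaging.\<close>

lemma sum_prod_chan_inputs:
  "length ys = N \<Longrightarrow> (\<Sum>xs\<in>outseqs N. prod_chan W xs ys) = real CARD('x) ^ N * Q ys"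
proof (induction N arbitrary: ys)
  case 0
  then show ?case by (simp add: prod_chan_def)
next
  case (Suc N)
  then obtain ys' y where ys: "ys = ys' @ [y]" "length ys' = N"
    by (metis length_Suc_conv_rev)
  have "prod_chan W (xs @ [x]) ys = prod_chan W xs ys' * W x y" if "xs \<in> outseqs N" for xs x
    using that ys by (auto simp: prod_chan_def outseqs_def nth_append intro!: prod.cong)
  then have "(\<Sum>xs\<in>outseqs (Suc N). prod_chan W xs ys) = (\<Sum>xs\<in>outseqs N. prod_chan W xs ys') * (\<Sum>x\<in>UNIV. W x y)"
    by (simp add: sum_outseqs_Suc sum_product)
  also have "\<dots> = real CARD('x) ^ Suc N * Q ys"
  proof -
    have "(\<Sum>x\<in>UNIV. W x y) = real CARD('x) * q y" by (simp add: q_def)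
    then show ?thesis using Suc.IH[OF ys(2)] ys by simp
  qed
  finally show ?case .
qed

section \<open>Lower bound on the error probability with feedback\<close>

lemma finite_msgs [simp]: "finite (msgs N R)"
  by (simp add: msgs_def)

lemma card_msgs: "exp (N * R) \<le> card (msgs N R)" "card (msgs N R) \<le> exp (N * R) + 1"
  by (simp_all add: msgs_def)

lemma card_msgs_pos: "card (msgs N R) > 0"
  using card_msgs(1)[of N R] exp_gt_zero[of "N * R"] by linarith

lemma one_in_msgs: "1 \<in> msgs N R"
  by (simp add: msgs_def Suc_le_eq)

text \<open>On \<open>Z ys \<le> t\<close> every message has likelihood at most \<open>exp t\<close> times the output law \<open>Q\<close>,
  so that a fraction \<open>exp t / card msgs\<close> is decoded correctly at best.\<close>
lemma avg_err_fb_ge: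
  assumes \<phi>: "fb_code N R \<phi>"
  shows "(1 - exp (t - N * R)) * (\<Sum>ys\<in>{ys\<in>outseqs N. Z ys \<le> t}. Q ys) \<le> avg_err_fb W N R enc \<phi>"
proof -
  define G where "G = {ys\<in>outseqs N. Z ys \<le> t}"
  define M where "M = card (msgs N R)"
  define qG where "qG = (\<Sum>ys\<in>G. Q ys)"
  have [simp]: "finite G" by (simp add: G_def)
  have qG: "0 \<le> qG" unfolding qG_def by (intro sum_nonneg Q_nonneg)
  have M: "M > 0" "exp (N * R) \<le> M" using card_msgs_pos card_msgs(1) by (simp_all add: M_def)
  have fbG: "(\<Sum>ys\<in>G. fb_prob W N enc m ys) = qG" for m
    using sum_fb_prob[of N enc m "\<lambda>zs. of_bool (sum_list zs \<le> t)"]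
    by (simp add: G_def qG_def sum.inter_filter of_bool_def if_distrib cong: if_cong)
  \<comment> \<open>Each message puts mass qG on G, so the total mass M qG minus the correctly
    decoded part is the erroneous part.\<close>
  have "M * qG - (\<Sum>ys\<in>G. fb_prob W N enc (\<phi> ys) ys) =
      (\<Sum>m\<in>msgs N R. \<Sum>ys\<in>G. if \<phi> ys \<noteq> m then fb_prob W N enc m ys else 0)"
  proof -
    have "(\<Sum>ys\<in>G. fb_prob W N enc (\<phi> ys) ys) = (\<Sum>ys\<in>G. \<Sum>m\<in>msgs N R. if \<phi> ys = m then fb_prob W N enc m ys else 0)"
      using \<phi> by (intro sum.cong refl) (auto simp: fb_code_def G_def)
    also have "\<dots> = (\<Sum>m\<in>msgs N R. \<Sum>ys\<in>G. if \<phi> ys = m then fb_prob W N enc m ys else 0)"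
      by (rule sum.swap)
    finally have "M * qG - (\<Sum>ys\<in>G. fb_prob W N enc (\<phi> ys) ys) =
        (\<Sum>m\<in>msgs N R. (\<Sum>ys\<in>G. fb_prob W N enc m ys) - (\<Sum>ys\<in>G. if \<phi> ys = m then fb_prob W N enc m ys else 0))"
      by (simp add: fbG sum_subtractf M_def)
    also have "\<dots> = (\<Sum>m\<in>msgs N R. \<Sum>ys\<in>G. if \<phi> ys \<noteq> m then fb_prob W N enc m ys else 0)"
      by (intro sum.cong refl) (auto simp flip: sum_subtractf intro!: sum.cong)
    finally show ?thesis .
  qed
  also have "\<dots> \<le> (\<Sum>m\<in>msgs N R. \<Sum>ys\<in>{ys\<in>outseqs N. \<phi> ys \<noteq> m}. fb_prob W N enc m ys)"
    by (intro sum_mono) (auto simp: sum.inter_filter[symmetric] G_def fb_prob_nonneg intro!: sum_mono2)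
  finally have "(M * qG - (\<Sum>ys\<in>G. fb_prob W N enc (\<phi> ys) ys)) / M \<le> avg_err_fb W N R enc \<phi>"
    unfolding avg_err_fb_def M_def[symmetric] by (intro divide_right_mono) auto
  moreover have "(\<Sum>ys\<in>G. fb_prob W N enc (\<phi> ys) ys) \<le> exp t * qG"
    unfolding qG_def sum_distrib_left
  proof (rule sum_mono)
    fix ys assume "ys \<in> G"
    then have "fb_prob W N enc (\<phi> ys) ys \<le> Q ys * exp (Z ys)" "Z ys \<le> t"
      using fb_prob_le by (auto simp: G_def)
    moreover have "Q ys * exp (Z ys) \<le> Q ys * exp t"
      using \<open>Z ys \<le> t\<close> by (intro mult_left_mono Q_nonneg) simp
    ultimately show "fb_prob W N enc (\<phi> ys) ys \<le> exp t * Q ys" by (simp add: mult.commute)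
  qed
  moreover have "exp t * qG / M \<le> exp (t - N * R) * qG"
  proof -
    have "exp t * qG / M \<le> exp t * qG / exp (N * R)"
      using M qG by (intro divide_left_mono) auto
    then show ?thesis by (simp add: exp_diff)
  qed
  moreover have "(M * qG - s) / M = qG - s / M" for s using M by (simp add: field_simps)
  moreover have "s / M \<le> exp t * qG / M" if "s \<le> exp t * qG" for s
    using that by (rule divide_right_mono) simp
  ultimately have "qG - exp (t - N * R) * qG \<le> avg_err_fb W N R enc \<phi>"
    by (smt (verit))
  then show ?thesis by (simp add: qG_def G_def left_diff_distrib)
qed

lemma Pe_fb_ge:
  "(1 - exp (t - N * R)) * (\<Sum>ys\<in>{ys\<in>outseqs N. Z ys \<le> t}. Q ys) \<le> Pe_fb W N R"
  unfolding Pe_fb_def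
proof (rule cInf_greatest)
  have "fb_code N R (\<lambda>ys :: 'y list. 1)" using one_in_msgs by (simp add: fb_code_def)
  then show "{avg_err_fb W N R enc \<phi> | enc \<phi>. fb_code N R \<phi>} \<noteq> {}" by blast
  fix e assume "e \<in> {avg_err_fb W N R enc \<phi> | enc \<phi>. fb_code N R \<phi>}"
  then obtain enc \<phi> where "e = avg_err_fb W N R enc \<phi>" "fb_code N R \<phi>" by blast
  then show "(1 - exp (t - N * R)) * (\<Sum>ys\<in>{ys\<in>outseqs N. Z ys \<le> t}. Q ys) \<le> e"
    using avg_err_fb_ge by simp
qed

text \<open>Take the threshold t = N z(y), which lies below NR: the constant word of y's satisfies
  it and has positive probability. This handles the blocklengths below the reach of the asymptotic
  bound.\<close>

lemma Pe_fb_pos: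
  assumes "q y > 0" "z y < R" "N \<ge> 1"
  shows "0 < Pe_fb W N R"
proof -
  have "0 < 1 - exp (N * z y - N * R)" using assms by simp
  moreover have "0 < (\<Sum>ys\<in>{ys\<in>outseqs N. Z ys \<le> N * z y}. Q ys)"
  proof (rule sum_pos2[of _ "replicate N y"])
    show "replicate N y \<in> {ys\<in>outseqs N. Z ys \<le> N * z y}" by (simp add: outseqs_def sum_list_replicate)
    show "0 < Q (replicate N y)" using assms by (simp add: prod_list_replicate)
  qed (auto intro: Q_nonneg)
  ultimately have "0 < (1 - exp (N * z y - N * R)) * (\<Sum>ys\<in>{ys\<in>outseqs N. Z ys \<le> N * z y}. Q ys)"
    by (rule mult_pos_pos)
  then show ?thesis using Pe_fb_ge by (rule less_le_trans)
qed

section \<open>Upper bound on the error probability by a greedy codebook\<close>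

definition ach_bound :: "nat \<Rightarrow> real \<Rightarrow> real" where
  "ach_bound N R = (\<Sum>ys\<in>outseqs N. Q ys *
     (if Z ys \<le> N * R then 1 else card (msgs N R) * exp (- Z ys)))"

text \<open>An output sequence compatible with a codeword has likelihood \<open>Q ys * exp (Z ys)\<close>, so
  the set of sequences of density \<open>Z ys = s\<close> compatible with a codeword has \<open>Q\<close>-probability
  \<open>exp (- s)\<close> times that of the density level set: the union bound holds for every codebook.\<close>
lemma covered_outputs_le:
  assumes J: "finite J" "card J \<le> card (msgs N R)"
  shows "(\<Sum>ys\<in>{ys\<in>outseqs N. \<exists>j\<in>J. prod_chan W (f j) ys > 0}. Q ys) \<le> ach_bound N R"
proof -
  \<comment> \<open>Above NR, multiplying the likelihood of a compatible codeword by k gives back Q.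
    As k depends on the densities only, \<open>sum_prod_chan\<close> evaluates the resulting sum
    alike for every codeword.\<close>
  define k where "k zs = (if sum_list zs \<le> N * R then 0 else exp (- sum_list zs))" for zs
  have k: "k zs \<ge> 0" for zs by (simp add: k_def)
  have "(\<Sum>ys\<in>{ys\<in>outseqs N. \<exists>j\<in>J. prod_chan W (f j) ys > 0}. Q ys) \<le>
      (\<Sum>ys\<in>{ys\<in>outseqs N. \<exists>j\<in>J. prod_chan W (f j) ys > 0}.
        Q ys * of_bool (Z ys \<le> N * R) + (\<Sum>j\<in>J. prod_chan W (f j) ys * k (map z ys)))"
  proof (rule sum_mono)
    fix ys assume "ys \<in> {ys\<in>outseqs N. \<exists>j\<in>J. prod_chan W (f j) ys > 0}"
    then obtain j where j: "j \<in> J" "prod_chan W (f j) ys > 0" by blast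
    have sum: "prod_chan W (f j) ys * k (map z ys) \<le> (\<Sum>j\<in>J. prod_chan W (f j) ys * k (map z ys))"
      using j J k prod_chan_nonneg by (intro member_le_sum mult_nonneg_nonneg) auto
    show "Q ys \<le> Q ys * of_bool (Z ys \<le> N * R) + (\<Sum>j\<in>J. prod_chan W (f j) ys * k (map z ys))"
    proof (cases "Z ys \<le> N * R")
      case True
      moreover have "0 \<le> prod_chan W (f j) ys * k (map z ys)" by (intro mult_nonneg_nonneg prod_chan_nonneg k)
      ultimately show ?thesis using sum by simp
    next
      case False
      then have "prod_chan W (f j) ys * k (map z ys) = Q ys"
        using prod_W_eq[where a = "\<lambda>i. f j ! i" and ys = ys] j(2) by (simp add: prod_chan_def k_def exp_minus)
      then show ?thesis using sum Q_nonneg[of ys] by simp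
    qed
  qed
  also have "\<dots> \<le> (\<Sum>ys\<in>outseqs N.
        Q ys * of_bool (Z ys \<le> N * R) + (\<Sum>j\<in>J. prod_chan W (f j) ys * k (map z ys)))"
    by (intro sum_mono2) (auto intro!: add_nonneg_nonneg mult_nonneg_nonneg Q_nonneg sum_nonneg k prod_chan_nonneg)
  also have "\<dots> = (\<Sum>ys\<in>outseqs N. Q ys * of_bool (Z ys \<le> N * R)) +
      (\<Sum>j\<in>J. \<Sum>ys\<in>outseqs N. prod_chan W (f j) ys * k (map z ys))"
    unfolding sum.distrib by (subst (2) sum.swap) (rule refl)
  also have "\<dots> = (\<Sum>ys\<in>outseqs N. Q ys * of_bool (Z ys \<le> N * R)) + card J * (\<Sum>ys\<in>outseqs N. Q ys * k (map z ys))"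
    by (simp add: sum_prod_chan)
  also have "\<dots> \<le> (\<Sum>ys\<in>outseqs N. Q ys * of_bool (Z ys \<le> N * R)) + card (msgs N R) * (\<Sum>ys\<in>outseqs N. Q ys * k (map z ys))"
    using J(2) by (intro add_left_mono mult_right_mono) (auto intro!: sum_nonneg mult_nonneg_nonneg Q_nonneg k)
  also have "\<dots> = ach_bound N R"
    unfolding ach_bound_def sum_distrib_left sum.distrib[symmetric]
    by (intro sum.cong refl) (simp add: k_def)
  finally show ?thesis .
qed

text \<open>Averaged over all input words, the probability of hitting the outputs already covered is
  their Q-probability, so some word does no worse than the average.\<close>

lemma ex_next_codeword:
  assumes J: "finite J" "card J \<le> card (msgs N R)"
  shows "\<exists>xs\<in>outseqs N. (\<Sum>ys\<in>{ys\<in>outseqs N. \<exists>j\<in>J. prod_chan W (f j) ys > 0}. prod_chan W xs ys) \<le> ach_bound N R"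
proof (rule ccontr)
  define B where "B = {ys\<in>outseqs N. \<exists>j\<in>J. prod_chan W (f j) ys > 0}"
  assume "\<not> ?thesis"
  then have "ach_bound N R < (\<Sum>ys\<in>B. prod_chan W xs ys)" if "xs \<in> outseqs N" for xs
    using that by (auto simp: B_def not_le)
  moreover have ne: "outseqs N \<noteq> ({} :: 'x list set)"
    using Ex_list_of_length[of N] by (auto simp: outseqs_def)
  ultimately have "(\<Sum>xs\<in>(outseqs N :: 'x list set). ach_bound N R) < (\<Sum>xs\<in>outseqs N. \<Sum>ys\<in>B. prod_chan W xs ys)"
    by (intro sum_strict_mono) auto
  also have "\<dots> = (\<Sum>ys\<in>B. \<Sum>xs\<in>outseqs N. prod_chan W xs ys)"
    by (rule sum.swap)
  also have "\<dots> = (\<Sum>ys\<in>B. real CARD('x) ^ N * Q ys)"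
    by (intro sum.cong refl sum_prod_chan_inputs) (auto simp: B_def outseqs_def)
  also have "\<dots> = real CARD('x) ^ N * (\<Sum>ys\<in>B. Q ys)"
    by (simp add: sum_distrib_left)
  also have "\<dots> \<le> real CARD('x) ^ N * ach_bound N R"
    unfolding B_def by (intro mult_left_mono covered_outputs_le J) simp
  also have "\<dots> = (\<Sum>xs\<in>(outseqs N :: 'x list set). ach_bound N R)"
    using card_lists_length_eq[of "UNIV :: 'x set" N] by (simp add: outseqs_def)
  finally show False by simp
qed

text \<open>Each codeword is constrained only by its predecessors, so later choices leave earlier
  bounds intact. The bound thus holds for every message, as the maximal error requires.\<close>

lemma ex_codebook:
  "n \<le> card (msgs N R) \<Longrightarrow> \<exists>f. \<forall>m\<in>{1..n}. f m \<in> outseqs N \<and>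
     (\<Sum>ys\<in>{ys\<in>outseqs N. \<exists>j\<in>{1..<m}. prod_chan W (f j) ys > 0}. prod_chan W (f m) ys) \<le> ach_bound N R"
proof (induction n)
  case (Suc n)
  have "n \<le> card (msgs N R)" using Suc.prems by simp
  then obtain f where "\<forall>m\<in>{1..n}. f m \<in> outseqs N \<and>
     (\<Sum>ys\<in>{ys\<in>outseqs N. \<exists>j\<in>{1..<m}. prod_chan W (f j) ys > 0}. prod_chan W (f m) ys) \<le> ach_bound N R"
    using Suc.IH by blast
  note f = bspec[OF this]
  obtain xs where xs: "xs \<in> outseqs N"
    "(\<Sum>ys\<in>{ys\<in>outseqs N. \<exists>j\<in>{1..n}. prod_chan W (f j) ys > 0}. prod_chan W xs ys) \<le> ach_bound N R"
    using ex_next_codeword[of "{1..n}" N R f] Suc.prems by auto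
  define g where "g = f(Suc n := xs)"
  have "(\<exists>j\<in>{1..<m}. prod_chan W (g j) ys > 0) \<longleftrightarrow> (\<exists>j\<in>{1..<m}. prod_chan W (f j) ys > 0)" if "m \<le> Suc n" for m ys
    using that by (intro bex_cong) (auto simp: g_def)
  then have "g m \<in> outseqs N \<and>
     (\<Sum>ys\<in>{ys\<in>outseqs N. \<exists>j\<in>{1..<m}. prod_chan W (g j) ys > 0}. prod_chan W (g m) ys) \<le> ach_bound N R"
    if "m \<in> {1..Suc n}" for m
    using f[of m] xs that by (cases "m = Suc n") (auto simp: g_def atLeastLessThanSuc_atLeastAtMost)
  then show ?case by blast
qed simp

lemma Pe_le: "Pe W N R \<le> ach_bound N R"
proof -
  define M where "M = card (msgs N R)"
  have msgs: "msgs N R = {1..M}" by (simp add: M_def msgs_def)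
  obtain f where "\<forall>m\<in>{1..M}. f m \<in> outseqs N \<and>
       (\<Sum>ys\<in>{ys\<in>outseqs N. \<exists>j\<in>{1..<m}. prod_chan W (f j) ys > 0}. prod_chan W (f m) ys) \<le> ach_bound N R"
    using ex_codebook[of M N R] unfolding M_def by blast
  note f = bspec[OF this, THEN conjunct1] bspec[OF this, THEN conjunct2]
  define ok where "ok ys m \<longleftrightarrow> m \<in> {1..M} \<and> prod_chan W (f m) ys > 0" for ys m
  \<comment> \<open>An error on message m needs an earlier compatible codeword, because the true one
    is compatible with probability 1. The default 1 keeps the decoder inside the message
    set.\<close>
  define \<phi> where "\<phi> ys = (if \<exists>m. ok ys m then LEAST m. ok ys m else 1)" for ys
  have \<phi>: "\<phi> ys \<in> {1..M}" for ys
    using LeastI_ex[of "ok ys"] one_in_msgs[of N R] unfolding msgs by (auto simp: \<phi>_def ok_def)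
  have code: "block_code N R f \<phi>"
    using f(1) \<phi> by (auto simp: block_code_def msgs outseqs_def)
  have "code_err W N f \<phi> m \<le> ach_bound N R" if m: "m \<in> {1..M}" for m
  proof -
    have "ys \<in> outseqs N \<and> (\<exists>j\<in>{1..<m}. prod_chan W (f j) ys > 0)"
      if ys: "ys \<in> outseqs N" "\<phi> ys \<noteq> m" and nz: "prod_chan W (f m) ys \<noteq> 0" for ys
    proof -
      have ok: "ok ys m" using m nz prod_chan_nonneg[of "f m" ys] by (auto simp: ok_def)
      then have "ok ys (\<phi> ys)" "\<phi> ys \<le> m"
        using LeastI[of "ok ys" m] Least_le[of "ok ys" m] by (auto simp: \<phi>_def)
      then show ?thesis using ys by (intro conjI bexI[of _ "\<phi> ys"]) (auto simp: ok_def)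
    qed
    then have "code_err W N f \<phi> m =
        (\<Sum>ys\<in>{ys\<in>outseqs N. \<phi> ys \<noteq> m \<and> (\<exists>j\<in>{1..<m}. prod_chan W (f j) ys > 0)}. prod_chan W (f m) ys)"
      unfolding code_err_def by (intro sum.mono_neutral_right) auto
    also have "\<dots> \<le> (\<Sum>ys\<in>{ys\<in>outseqs N. \<exists>j\<in>{1..<m}. prod_chan W (f j) ys > 0}. prod_chan W (f m) ys)"
      by (intro sum_mono2) (auto intro: prod_chan_nonneg)
    also have "\<dots> \<le> ach_bound N R" by (rule f(2)[OF m])
    finally show ?thesis .
  qed
  then have "max_err W N R f \<phi> \<le> ach_bound N R"
    unfolding max_err_def using one_in_msgs[of N R] by (subst Max_le_iff) (auto simp: msgs)
  moreover have "Pe W N R \<le> max_err W N R f \<phi>"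
    unfolding Pe_def
  proof (rule cInf_lower)
    show "bdd_below {max_err W N R f \<phi> |f \<phi>. block_code N R f \<phi>}"
    proof (rule bdd_belowI[of _ 0])
      fix e assume "e \<in> {max_err W N R f \<phi> |f \<phi>. block_code N R f \<phi>}"
      then obtain f \<phi> where e: "e = max_err W N R f \<phi>" by blast
      have "0 \<le> code_err W N f \<phi> 1" unfolding code_err_def by (intro sum_nonneg prod_chan_nonneg)
      also have "\<dots> \<le> e" unfolding e max_err_def using one_in_msgs by (intro Max_ge) auto
      finally show "0 \<le> e" .
    qed
    show "max_err W N R f \<phi> \<in> {max_err W N R f \<phi> |f \<phi>. block_code N R f \<phi>}"
      using code by (intro CollectI exI[of _ f] exI[of _ \<phi>]) simp
  qed
  ultimately show ?thesis by simp
qed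

section \<open>Tilting\<close>

definition tilted_sum :: "real \<Rightarrow> real \<Rightarrow> real" where
  "tilted_sum R \<rho> = (\<Sum>y\<in>UNIV. q y * exp (- \<rho> * (z y - R)))"

text \<open>Minus the derivative of \<open>tilted_sum R\<close> with respect to the tilting
  parameter.\<close>

definition tilted_moment :: "real \<Rightarrow> real \<Rightarrow> real" where
  "tilted_moment R \<rho> = (\<Sum>y\<in>UNIV. q y * (z y - R) * exp (- \<rho> * (z y - R)))"

lemma tilted_sum_eq: "tilted_sum R \<rho> = mgf \<rho> * exp (\<rho> * R)"
  unfolding tilted_sum_def mgf_def sum_distrib_right
  by (intro sum.cong refl) (simp add: algebra_simps flip: exp_add)

lemma tilted_sum_pos: "0 < tilted_sum R \<rho>"
  by (simp add: tilted_sum_eq mgf_pos)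

lemma ln_tilted_sum: "- ln (tilted_sum R \<rho>) = - ln (mgf \<rho>) - \<rho> * R"
  using mgf_pos[of \<rho>] by (simp add: tilted_sum_eq ln_mult)

text \<open>Convexity, termwise from 1 + x \<le> exp x. In particular a zero of
  \<open>tilted_moment R\<close> is a global minimum of \<open>tilted_sum R\<close>.\<close>

lemma tilted_sum_tangent:
  "tilted_sum R \<rho>' - (\<rho> - \<rho>') * tilted_moment R \<rho>' \<le> tilted_sum R \<rho>"
proof -
  have "q y * exp (- \<rho>' * d) - (\<rho> - \<rho>') * (q y * d * exp (- \<rho>' * d)) \<le> q y * exp (- \<rho> * d)" for y d
  proof -
    have "exp (- \<rho>' * d) * (1 + - (\<rho> - \<rho>') * d) \<le> exp (- \<rho>' * d) * exp (- (\<rho> - \<rho>') * d)"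
      by (intro mult_left_mono exp_ge_add_one_self) simp
    also have "\<dots> = exp (- \<rho> * d)" by (simp add: algebra_simps flip: exp_add)
    finally have "q y * (exp (- \<rho>' * d) * (1 + - (\<rho> - \<rho>') * d)) \<le> q y * exp (- \<rho> * d)"
      by (intro mult_left_mono q_nonneg)
    then show ?thesis by (simp add: algebra_simps)
  qed
  then show ?thesis
    unfolding tilted_sum_def tilted_moment_def sum_distrib_left sum_subtractf[symmetric]
    by (intro sum_mono)
qed

lemma tilted_moment_0: "tilted_moment R 0 = mean - R"
  by (simp add: tilted_moment_def mean_def right_diff_distrib sum_subtractf q_sum flip: sum_distrib_right)

lemma continuous_tilted_moment: "continuous_on A (tilted_moment R)"
  unfolding tilted_moment_def by (intro continuous_intros)

text \<open>The moment is mean - R > 0 at 0. It turns negative for a large parameter because the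
  weight of y0, where z lies below R, grows exponentially; the intermediate value theorem does the
  rest.\<close>

lemma ex_tilt:
  assumes y0: "q y0 > 0" "z y0 < R" and R: "R < mean"
  obtains \<rho> where "\<rho> > 0" "tilted_moment R \<rho> = 0"
proof -
  define B where "B = (\<Sum>y\<in>UNIV. q y * \<bar>z y - R\<bar>)"
  define d where "d = R - z y0"
  have d: "d > 0" using y0 by (simp add: d_def)
  have B: "B \<ge> 0" unfolding B_def by (intro sum_nonneg mult_nonneg_nonneg q_nonneg) simp
  \<comment> \<open>Chosen so that already the linear bound 1 + r d \<le> exp(r d) makes the term of
    y0 outweigh B, which bounds all the other terms.\<close>
  define r where "r = B / (q y0 * d\<^sup>2)"
  have r: "r \<ge> 0" using B q_nonneg[of y0] by (simp add: r_def)
  have le: "q y * (z y - R) * exp (- r * (z y - R)) \<le> q y * \<bar>z y - R\<bar>" for y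
  proof (cases "z y \<le> R")
    case True
    then have "q y * (z y - R) * exp (- r * (z y - R)) \<le> 0"
      using q_nonneg[of y] by (intro mult_nonpos_nonneg mult_nonneg_nonpos) auto
    then show ?thesis using q_nonneg[of y] by (meson abs_ge_zero mult_nonneg_nonneg order_trans)
  next
    case False
    then have "exp (- r * (z y - R)) \<le> 1" using r by simp
    then have "q y * (z y - R) * exp (- r * (z y - R)) \<le> q y * (z y - R) * 1"
      using False q_nonneg[of y] by (intro mult_left_mono mult_nonneg_nonneg) auto
    then show ?thesis using False by simp
  qed
  have y0_le: "q y0 * (z y0 - R) * exp (- r * (z y0 - R)) \<le> - B - q y0 * d"
  proof -
    have "q y0 * d * (1 + r * d) \<le> q y0 * d * exp (r * d)"
      using y0 d by (intro mult_left_mono exp_ge_add_one_self) auto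
    moreover have "q y0 * d * (1 + r * d) = q y0 * d + B"
      using y0 d by (simp add: r_def field_simps power2_eq_square)
    ultimately show ?thesis by (simp add: d_def algebra_simps)
  qed
  have "tilted_moment R r = q y0 * (z y0 - R) * exp (- r * (z y0 - R)) +
      (\<Sum>y\<in>UNIV - {y0}. q y * (z y - R) * exp (- r * (z y - R)))"
    unfolding tilted_moment_def by (rule sum.remove) simp_all
  also have "\<dots> \<le> (- B - q y0 * d) + (\<Sum>y\<in>UNIV - {y0}. q y * \<bar>z y - R\<bar>)"
    by (intro add_mono y0_le sum_mono le)
  also have "\<dots> \<le> (- B - q y0 * d) + B"
    unfolding B_def by (intro add_left_mono sum_mono2) (auto intro: mult_nonneg_nonneg q_nonneg)
  also have "\<dots> < 0" using y0 d by simp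
  finally have neg: "tilted_moment R r < 0" .
  then obtain \<rho> where \<rho>: "0 \<le> \<rho>" "\<rho> \<le> r" "tilted_moment R \<rho> = 0"
    using IVT2'[of "tilted_moment R" r 0 0] r R continuous_tilted_moment
    by (auto simp: tilted_moment_0)
  have "\<rho> \<noteq> 0" using \<rho>(3) R by (auto simp: tilted_moment_0)
  then have "\<rho> > 0" using \<rho>(1) by simp
  then show ?thesis using \<rho>(3) by (rule that)
qed

lemma tilted_iid_centred:
  assumes "tilted_moment R \<rho> = 0" "q y0 > 0" "z y0 < R"
  shows "iid_centred (\<lambda>y. q y * exp (- \<rho> * (z y - R)) / tilted_sum R \<rho>) (\<lambda>y. z y - R)"
proof
  show "0 \<le> q y * exp (- \<rho> * (z y - R)) / tilted_sum R \<rho>" for y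
    using q_nonneg[of y] tilted_sum_pos[of R \<rho>] by (intro divide_nonneg_nonneg mult_nonneg_nonneg) auto
  show "(\<Sum>y\<in>UNIV. q y * exp (- \<rho> * (z y - R)) / tilted_sum R \<rho>) = 1"
    using tilted_sum_pos[of R \<rho>] by (simp add: tilted_sum_def flip: sum_divide_distrib)
  have "(\<Sum>y\<in>UNIV. q y * exp (- \<rho> * (z y - R)) / tilted_sum R \<rho> * (z y - R)) = tilted_moment R \<rho> / tilted_sum R \<rho>"
    unfolding tilted_moment_def sum_divide_distrib by (intro sum.cong refl) simp
  then show "(\<Sum>y\<in>UNIV. q y * exp (- \<rho> * (z y - R)) / tilted_sum R \<rho> * (z y - R)) = 0"
    by (simp only: assms(1) div_0)
  show "\<exists>y. q y * exp (- \<rho> * (z y - R)) / tilted_sum R \<rho> * (z y - R) \<noteq> 0"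
    using assms(2,3) tilted_sum_pos[of R \<rho>] by (intro exI[of _ y0]) auto
qed

text \<open>Change of measure: relative to the tilted product law, the density of Q depends on the
  centred sum only, apart from the constant \<open>tilted_sum R \<rho> ^ N\<close> that carries the
  exponent.\<close>

lemma Q_tilted:
  assumes "ys \<in> outseqs N"
  shows "Q ys = tilted_sum R \<rho> ^ N * exp (\<rho> * sum_list (map (\<lambda>y. z y - R) ys)) *
    prod_list (map (\<lambda>y. q y * exp (- \<rho> * (z y - R)) / tilted_sum R \<rho>) ys)"
proof -
  have "q y = tilted_sum R \<rho> * (exp (\<rho> * (z y - R)) * (q y * exp (- \<rho> * (z y - R)) / tilted_sum R \<rho>))" for y
    using tilted_sum_pos[of R \<rho>] by (simp flip: exp_add)
  then have "Q ys = prod_list (map (\<lambda>y. tilted_sum R \<rho> * (exp (\<rho> * (z y - R)) * (q y * exp (- \<rho> * (z y - R)) / tilted_sum R \<rho>))) ys)"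
    by (intro arg_cong[of _ _ prod_list] map_cong refl)
  also have "\<dots> = prod_list (map (\<lambda>y. tilted_sum R \<rho>) ys) * (prod_list (map (\<lambda>y. exp (\<rho> * (z y - R))) ys) *
      prod_list (map (\<lambda>y. q y * exp (- \<rho> * (z y - R)) / tilted_sum R \<rho>) ys))"
    by (simp only: prod_list_mult_map)
  also have "prod_list (map (\<lambda>y. tilted_sum R \<rho>) ys) = tilted_sum R \<rho> ^ N"
    using assms by (simp add: outseqs_def map_replicate_const prod_list_replicate)
  also have "prod_list (map (\<lambda>y. exp (\<rho> * (z y - R))) ys) = exp (\<rho> * sum_list (map (\<lambda>y. z y - R) ys))"
    by (simp only: prod_list_exp sum_list_const_mult)
  finally show ?thesis by (simp only: mult.assoc)
qed

lemma sum_list_z_diff: "ys \<in> outseqs N \<Longrightarrow> sum_list (map (\<lambda>y. z y - R) ys) = Z ys - N * R"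
proof -
  have "sum_list (map (\<lambda>y. z y - R) ys) = Z ys - length ys * R"
    by (induction ys) (simp_all add: algebra_simps)
  then show "ys \<in> outseqs N \<Longrightarrow> ?thesis" by (simp add: outseqs_def)
qed

lemma ach_bound_le:
  assumes y0: "q y0 > 0" "z y0 < R" and \<rho>: "0 < \<rho>" "\<rho> < 1" "tilted_moment R \<rho> = 0" and R: "R \<ge> 0"
  obtains K where "K > 0" "\<And>N. N \<ge> 1 \<Longrightarrow> ach_bound N R \<le> K / sqrt N * tilted_sum R \<rho> ^ N"
proof -
  define p where "p = (\<lambda>y. q y * exp (- \<rho> * (z y - R)) / tilted_sum R \<rho>)"
  define X where "X = (\<lambda>y. z y - R)"
  interpret T: iid_centred p X
    unfolding p_def X_def using tilted_iid_centred[OF \<rho>(3) y0] .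
  \<comment> \<open>The smaller of the decay rates of the tilted weights: \<rho> below the threshold
    NR and 1 - \<rho> above it.\<close>
  define \<beta> where "\<beta> = min \<rho> (1 - \<rho>)"
  have "\<beta> > 0" using \<rho> by (simp add: \<beta>_def)
  then obtain C where C: "C > 0"
    "\<And>N. N \<ge> 1 \<Longrightarrow> (\<Sum>ys\<in>outseqs N. T.P ys * exp (- \<beta> * \<bar>T.S ys\<bar>)) \<le> C / sqrt N"
    by (rule T.exp_abs_concentration) (rule that; assumption)
  have "ach_bound N R \<le> 2 * C / sqrt N * tilted_sum R \<rho> ^ N" if N: "N \<ge> 1" for N
  proof -
    define M where "M = real (card (msgs N R))"
    \<comment> \<open>Rounding up adds at most 1, which is at most exp(NR) because R is
      nonnegative.\<close>
    have M: "M \<le> 2 * exp (N * R)"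
    proof -
      have "1 \<le> exp (N * R)" using R by simp
      then show ?thesis using card_msgs(2)[of N R] unfolding M_def by linarith
    qed
    have "Q ys * (if Z ys \<le> N * R then 1 else M * exp (- Z ys)) \<le>
        2 * tilted_sum R \<rho> ^ N * (T.P ys * exp (- \<beta> * \<bar>T.S ys\<bar>))" if ys: "ys \<in> outseqs N" for ys
    proof -
      define D where "D = Z ys - N * R"
      have D: "T.S ys = D" using sum_list_z_diff[OF ys, of R] by (simp add: D_def X_def)
      have e: "exp (- \<rho> * D) * exp (- \<beta> * \<bar>D\<bar>) = exp (- \<rho> * D + - \<beta> * \<bar>D\<bar>)"
        by (rule exp_add[symmetric])
      have "(if Z ys \<le> N * R then 1 else M * exp (- Z ys)) \<le> 2 * exp (- \<rho> * D + - \<beta> * \<bar>D\<bar>)"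
      proof (cases "D \<le> 0")
        case True
        have "\<beta> - \<rho> \<le> 0" by (simp add: \<beta>_def)
        then have "0 \<le> (\<beta> - \<rho>) * D" using True by (intro mult_nonpos_nonpos)
        also have "\<dots> = - \<rho> * D + - \<beta> * \<bar>D\<bar>" using True by (simp add: left_diff_distrib)
        finally have "1 \<le> exp (- \<rho> * D + - \<beta> * \<bar>D\<bar>)" by (simp only: one_le_exp_iff)
        moreover have "Z ys \<le> N * R" using True by (simp add: D_def)
        ultimately show ?thesis by (simp only: if_True)
      next
        case False
        have "M * exp (- Z ys) \<le> 2 * exp (N * R) * exp (- Z ys)" using M by (rule mult_right_mono) simp
        also have "\<dots> = 2 * exp (N * R + - Z ys)" by (simp only: exp_add mult.assoc)
        also have "N * R + - Z ys = - 1 * D" by (simp add: D_def)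
        finally have "M * exp (- Z ys) \<le> 2 * exp (- 1 * D)" .
        also have "\<dots> \<le> 2 * exp (- \<rho> * D + - \<beta> * \<bar>D\<bar>)"
        proof -
          have "\<rho> + \<beta> \<le> 1" by (simp add: \<beta>_def)
          then have "(\<rho> + \<beta>) * D \<le> 1 * D" using False by (intro mult_right_mono) simp_all
          moreover have "\<bar>D\<bar> = D" using False by simp
          ultimately have "- 1 * D \<le> - \<rho> * D + - \<beta> * \<bar>D\<bar>" by (simp add: distrib_right)
          then show ?thesis by (simp only: exp_le_cancel_iff mult_le_cancel_left_pos zero_less_numeral)
        qed
        finally show ?thesis using False by (simp add: D_def)
      qed
      then have "(if Z ys \<le> N * R then 1 else M * exp (- Z ys)) \<le> 2 * (exp (- \<rho> * D) * exp (- \<beta> * \<bar>D\<bar>))"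
        by (simp only: e)
      then have "Q ys * (if Z ys \<le> N * R then 1 else M * exp (- Z ys)) \<le> Q ys * (2 * (exp (- \<rho> * D) * exp (- \<beta> * \<bar>D\<bar>)))"
        by (intro mult_left_mono Q_nonneg)
      also have "\<dots> = 2 * tilted_sum R \<rho> ^ N * (T.P ys * exp (- \<beta> * \<bar>D\<bar>))"
      proof -
        have "Q ys = tilted_sum R \<rho> ^ N * exp (\<rho> * D) * T.P ys"
          using Q_tilted[OF ys, of R \<rho>] D by (simp only: p_def X_def)
        then have "Q ys * (2 * (exp (- \<rho> * D) * exp (- \<beta> * \<bar>D\<bar>))) =
            (exp (\<rho> * D) * exp (- \<rho> * D)) * (2 * tilted_sum R \<rho> ^ N * (T.P ys * exp (- \<beta> * \<bar>D\<bar>)))"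
          by (simp only: ac_simps)
        also have "exp (\<rho> * D) * exp (- \<rho> * D) = 1" by (simp flip: exp_add)
        finally show ?thesis by (simp only: mult_1)
      qed
      finally show ?thesis unfolding D .
    qed
    then have "(\<Sum>ys\<in>outseqs N. Q ys * (if Z ys \<le> N * R then 1 else M * exp (- Z ys))) \<le>
        (\<Sum>ys\<in>outseqs N. 2 * tilted_sum R \<rho> ^ N * (T.P ys * exp (- \<beta> * \<bar>T.S ys\<bar>)))"
      by (rule sum_mono)
    then have "ach_bound N R \<le> 2 * tilted_sum R \<rho> ^ N * (\<Sum>ys\<in>outseqs N. T.P ys * exp (- \<beta> * \<bar>T.S ys\<bar>))"
      by (simp only: ach_bound_def M_def sum_distrib_left)
    also have "\<dots> \<le> 2 * tilted_sum R \<rho> ^ N * (C / sqrt N)"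
      using tilted_sum_pos[of R \<rho>] by (intro mult_left_mono C(2)[OF N]) simp
    also have "\<dots> = 2 * C / sqrt N * tilted_sum R \<rho> ^ N" by simp
    finally show ?thesis .
  qed
  then show ?thesis using that[of "2 * C"] C(1) by simp
qed

lemma Pe_fb_asymptotic:
  assumes y0: "q y0 > 0" "z y0 < R" and \<rho>: "0 < \<rho>" "tilted_moment R \<rho> = 0"
  obtains K N0 where "K > 0" "\<And>N. N \<ge> N0 \<Longrightarrow> K / sqrt N * tilted_sum R \<rho> ^ N \<le> Pe_fb W N R"
proof -
  define p where "p = (\<lambda>y. q y * exp (- \<rho> * (z y - R)) / tilted_sum R \<rho>)"
  define X where "X = (\<lambda>y. z y - R)"
  interpret T: iid_centred p X
    unfolding p_def X_def using tilted_iid_centred[OF \<rho>(2) y0] .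
  obtain c L N0 where c: "c > 0" "L > 0"
    "\<And>N. N \<ge> N0 \<Longrightarrow> c / sqrt N \<le> (\<Sum>ys\<in>{ys\<in>outseqs N. - L \<le> T.S ys \<and> T.S ys \<le> - 1}. T.P ys)"
    by (rule T.window_lower_bound) (rule that; assumption)
  \<comment> \<open>The threshold t = NR - 1 contributes 1 - exp(- 1), the change of measure on the
    window at least exp(- \<rho> L), and the window itself c / sqrt N.\<close>
  define K where "K = (1 - exp (- 1)) * (exp (- \<rho> * L) * c)"
  have "K / sqrt N * tilted_sum R \<rho> ^ N \<le> Pe_fb W N R" if N: "N \<ge> N0" for N
  proof -
    define g where "g = tilted_sum R \<rho> ^ N"
    have g: "g > 0" using tilted_sum_pos by (simp add: g_def)
    have "g * exp (- \<rho> * L) * (c / sqrt N) \<le>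
        (\<Sum>ys\<in>{ys\<in>outseqs N. - L \<le> T.S ys \<and> T.S ys \<le> - 1}. g * exp (- \<rho> * L) * T.P ys)"
      unfolding sum_distrib_left[symmetric] using c(3)[OF N] g by (intro mult_left_mono) auto
    also have "\<dots> \<le> (\<Sum>ys\<in>{ys\<in>outseqs N. - L \<le> T.S ys \<and> T.S ys \<le> - 1}. Q ys)"
    proof (rule sum_mono)
      fix ys assume ys: "ys \<in> {ys\<in>outseqs N. - L \<le> T.S ys \<and> T.S ys \<le> - 1}"
      then have "\<rho> * - L \<le> \<rho> * T.S ys" using \<rho> by (intro mult_left_mono) auto
      then have "g * exp (- \<rho> * L) * T.P ys \<le> g * exp (\<rho> * T.S ys) * T.P ys"
        using g by (intro mult_right_mono mult_left_mono T.P_nonneg) auto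
      also have "\<dots> = Q ys" using Q_tilted[of ys N R \<rho>] ys by (simp add: p_def X_def g_def)
      finally show "g * exp (- \<rho> * L) * T.P ys \<le> Q ys" .
    qed
    also have "\<dots> \<le> (\<Sum>ys\<in>{ys\<in>outseqs N. Z ys \<le> N * R - 1}. Q ys)"
      using sum_list_z_diff[of _ N R] by (intro sum_mono2) (auto simp: X_def Q_nonneg)
    finally have le: "g * exp (- \<rho> * L) * (c / sqrt N) \<le> (\<Sum>ys\<in>{ys\<in>outseqs N. Z ys \<le> N * R - 1}. Q ys)" .
    have "K / sqrt N * tilted_sum R \<rho> ^ N = (1 - exp (- 1)) * (g * exp (- \<rho> * L) * (c / sqrt N))"
      by (simp add: K_def g_def)
    also have "\<dots> \<le> (1 - exp (- 1)) * (\<Sum>ys\<in>{ys\<in>outseqs N. Z ys \<le> N * R - 1}. Q ys)"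
      by (rule mult_left_mono[OF le]) simp
    also have "\<dots> \<le> Pe_fb W N R"
      using Pe_fb_ge[of "N * R - 1" N R] by simp
    finally show ?thesis .
  qed
  moreover have "K > 0" using c by (simp add: K_def)
  ultimately show ?thesis using that by blast
qed

section \<open>The Chernoff exponent, \<open>E_SP\<close>, \<open>R_inf\<close> and
  \<open>R_cr\<close>\<close>

text \<open>If every possible value of z exceeds R, with least value m, the lower bound in
  \<open>E_SP_ge\<close> is at least \<rho> (m - R) and so unbounded in \<rho>.\<close>

lemma E_SP_finite_imp_ge:
  assumes "E_SP W R \<noteq> \<infinity>"
  shows "\<exists>y. q y > 0 \<and> z y \<le> R"
proof (rule ccontr)
  assume none: "\<not> (\<exists>y. q y > 0 \<and> z y \<le> R)"
  define A where "A = {y. q y > 0}"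
  have A: "finite A" "A \<noteq> {}" using ex_q_pos by (auto simp: A_def)
  define m where "m = Min (z ` A)"
  have m: "m > R" unfolding m_def using A none by (subst Min_gr_iff) (auto simp: A_def not_le)
  have bound: "ereal (\<rho> * (m - R)) \<le> E_SP W R" if \<rho>: "\<rho> \<ge> 0" for \<rho>
  proof -
    have "mgf \<rho> \<le> (\<Sum>y\<in>UNIV. q y * exp (- \<rho> * m))"
      unfolding mgf_def
    proof (rule sum_mono)
      fix y
      show "q y * exp (- \<rho> * z y) \<le> q y * exp (- \<rho> * m)"
      proof (cases "q y > 0")
        case True
        then have "m \<le> z y" unfolding m_def using A by (intro Min_le) (auto simp: A_def)
        then show ?thesis using \<rho> True by (simp add: mult_left_mono)
      next
        case False
        then have "q y = 0" using q_nonneg[of y] by simp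
        then show ?thesis by simp
      qed
    qed
    also have "\<dots> = exp (- \<rho> * m)" by (simp add: q_sum flip: sum_distrib_right)
    finally have "ln (mgf \<rho>) \<le> ln (exp (- \<rho> * m))"
      using mgf_pos[of \<rho>] by (subst ln_le_cancel_iff) simp_all
    then have "\<rho> * (m - R) \<le> - ln (mgf \<rho>) - \<rho> * R" by (simp add: algebra_simps)
    then show ?thesis using E_SP_ge[OF \<rho>, of R] by (meson ereal_less_eq(3) order_trans)
  qed
  have "E_SP W R = \<infinity>"
  proof (rule ereal_top)
    fix B :: real
    have "B \<le> max 0 (B / (m - R)) * (m - R)"
      using m by (simp add: max_def divide_simps)
    then show "ereal B \<le> E_SP W R"
      using bound[of "max 0 (B / (m - R))"] by (meson ereal_less_eq(3) max.cobounded1 order_trans)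
  qed
  then show False using assms by simp
qed

lemma E_SP_nonneg: "0 \<le> E_SP W R"
  using E_SP_ge[of 0 R] q_sum by (simp add: mgf_def zero_ereal_def)

lemma real_E_SP_ge:
  assumes "E_SP W R \<noteq> \<infinity>" "\<rho> \<ge> 0"
  shows "- ln (tilted_sum R \<rho>) \<le> real_of_ereal (E_SP W R)"
  using E_SP_ge[OF assms(2), of R] E_SP_nonneg[of R] assms(1)
  by (cases "E_SP W R") (auto simp: ln_tilted_sum)

lemma above_R_inf:
  assumes "R_inf W < R"
  shows "E_SP W R \<noteq> \<infinity>" "\<exists>y. q y > 0 \<and> z y < R"
proof -
  have bdd: "bdd_above {R. E_SP W R = \<infinity>}"
  proof (rule bdd_aboveI[of _ mean])
    fix R assume "R \<in> {R. E_SP W R = \<infinity>}"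
    then show "R \<le> mean" using E_SP_le_0[of R] by (cases "mean \<le> R") auto
  qed
  have fin: "E_SP W R' \<noteq> \<infinity>" if "R_inf W < R'" for R'
    using cSup_upper[OF _ bdd, of R'] that by (auto simp: R_inf_def)
  show "E_SP W R \<noteq> \<infinity>" using fin assms by blast
  \<comment> \<open>Passing through an intermediate rate makes the inequality between z and R
    strict.\<close>
  obtain R' where R': "R_inf W < R'" "R' < R" using dense[OF assms] by blast
  then show "\<exists>y. q y > 0 \<and> z y < R" using E_SP_finite_imp_ge[OF fin] by fastforce
qed

lemma E_r_le_E_SP: "ereal (E_r W R) \<le> E_SP W R"
proof (cases "E_SP W R = \<infinity>")
  case False
  have "E_r W R \<le> real_of_ereal (E_SP W R)"
    using real_E_SP_ge[OF False] by (intro E_r_le) (simp add: ln_tilted_sum)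
  then show ?thesis using False E_SP_nonneg[of R] by (cases "E_SP W R") auto
qed simp

text \<open>Some R' < R has equal exponents. If the moment at parameter 1 were nonnegative for R, it
  would be positive for R'. Then \<open>tilted_sum R'\<close> would still decrease beyond 1, and a
  parameter above 1, admissible for \<open>E_SP\<close> but not for \<open>E_r\<close>, would
  separate the exponents.\<close>

lemma above_R_cr:
  assumes "R_cr W < R"
  shows "\<exists>y. q y > 0 \<and> z y < R" "tilted_moment R 1 < 0"
proof -
  \<comment> \<open>Both exponents vanish at \<open>mean\<close>, so the infimum defining
    \<open>R_cr\<close> runs over a nonempty set.\<close>
  have "ereal (E_r W mean) = E_SP W mean"
    using E_r_le_E_SP[of mean] E_SP_le_0[of mean] E_r_nonneg[of mean]
    by (metis ereal_less_eq(5) order_antisym order_trans order_refl)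
  then have "{R. ereal (E_r W R) = E_SP W R} \<noteq> {}" by blast
  then obtain R' where R': "ereal (E_r W R') = E_SP W R'" "R' < R"
    using assms cInf_lessD[of "{R. ereal (E_r W R) = E_SP W R}" R] by (auto simp: R_cr_def)
  have fin: "E_SP W R' \<noteq> \<infinity>" using R'(1) by (metis PInfty_neq_ereal(1))
  show "\<exists>y. q y > 0 \<and> z y < R"
    using E_SP_finite_imp_ge[OF fin] R'(2) by fastforce
  show "tilted_moment R 1 < 0"
  proof (rule ccontr)
    assume "\<not> tilted_moment R 1 < 0"
    \<comment> \<open>With exp R pulled out, the remaining sum is strictly decreasing in R.\<close>
    moreover have "tilted_moment R 1 = exp R * (\<Sum>y\<in>UNIV. q y * (z y - R) * exp (- z y))"
      unfolding tilted_moment_def sum_distrib_left by (intro sum.cong refl) (simp add: exp_diff exp_minus field_simps)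
    ultimately have "0 \<le> (\<Sum>y\<in>UNIV. q y * (z y - R) * exp (- z y))" by (simp add: not_less zero_le_mult_iff)
    also have "\<dots> < (\<Sum>y\<in>UNIV. q y * (z y - R') * exp (- z y))"
    proof -
      obtain y where y: "q y > 0" using ex_q_pos by blast
      have "q y * (z y - R) * exp (- z y) < q y * (z y - R') * exp (- z y)"
        using R'(2) y by simp
      moreover have "q y * (z y - R) * exp (- z y) \<le> q y * (z y - R') * exp (- z y)" for y
        using R'(2) q_nonneg[of y] by (intro mult_right_mono mult_left_mono) auto
      ultimately show ?thesis
        by (intro sum_strict_mono_ex1) auto
    qed
    finally have "0 < exp R' * (\<Sum>y\<in>UNIV. q y * (z y - R') * exp (- z y))" by simp
    also have "\<dots> = tilted_moment R' 1"
      unfolding tilted_moment_def sum_distrib_left by (intro sum.cong refl) (simp add: exp_diff exp_minus field_simps)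
    finally have h: "tilted_moment R' 1 > 0" .
    have "E_r W R' \<le> - ln (tilted_sum R' 1)"
    proof (rule E_r_le)
      fix \<rho> :: real assume "0 \<le> \<rho>" "\<rho> \<le> 1"
      then have "(\<rho> - 1) * tilted_moment R' 1 \<le> 0" using h by (intro mult_nonpos_nonneg) auto
      then have "tilted_sum R' 1 \<le> tilted_sum R' \<rho>" using tilted_sum_tangent[of R' 1 \<rho>] by simp
      then show "- ln (mgf \<rho>) - \<rho> * R' \<le> - ln (tilted_sum R' 1)"
        using tilted_sum_pos by (simp flip: ln_tilted_sum)
    qed
    \<comment> \<open>By continuity the moment stays positive just to the right of 1; the tangent
      there, evaluated at 1, gives the strict decrease.\<close>
    moreover obtain \<rho> where \<rho>: "\<rho> > 1" "tilted_sum R' \<rho> < tilted_sum R' 1"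
    proof -
      have "\<forall>\<^sub>F \<rho> in at_right 1. tilted_moment R' \<rho> > 0"
        using continuous_tilted_moment[of UNIV R'] h
        by (intro order_tendstoD(1)[of "tilted_moment R'" "tilted_moment R' 1"])
           (auto simp: continuous_on_eq_continuous_within isCont_def intro: tendsto_within_subset)
      moreover have "\<forall>\<^sub>F \<rho> in at_right (1::real). \<rho> > 1" by (rule eventually_at_right_less)
      ultimately obtain \<rho> where "tilted_moment R' \<rho> > 0" "\<rho> > 1"
        by (metis (mono_tags, lifting) eventually_conj eventually_happens' trivial_limit_at_right_real)
      then have "(1 - \<rho>) * tilted_moment R' \<rho> < 0" by (intro mult_neg_pos) auto
      then show ?thesis using tilted_sum_tangent[of R' \<rho> 1] that[OF \<open>\<rho> > 1\<close>] by simp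
    qed
    moreover have "- ln (tilted_sum R' \<rho>) \<le> E_r W R'"
      using real_E_SP_ge[OF fin, of \<rho>] \<rho>(1) by (simp flip: R'(1))
    moreover have "ln (tilted_sum R' \<rho>) < ln (tilted_sum R' 1)"
      using \<rho>(2) tilted_sum_pos by (subst ln_less_cancel_iff) auto
    ultimately show False by simp
  qed
qed

section \<open>The two error bounds at a fixed rate\<close>

lemma Pe_upper:
  assumes "R_cr W < R" "R < capacity W"
  shows "\<exists>K>0. \<forall>N\<ge>1. Pe W N R \<le> K / sqrt (real N) * exp (- real N * E_r W R)"
proof -
  obtain y0 where y0: "q y0 > 0" "z y0 < R" using above_R_cr(1)[OF assms(1)] by blast
  have R: "R \<ge> 0" using z_nonneg[of y0] y0 by simp
  have "R < mean" using assms(2) capacity_le_mean by simp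
  then have "0 \<le> tilted_moment R 0" by (simp add: tilted_moment_0)
  \<comment> \<open>The moment is positive at 0 because R < mean and negative at 1 because R >
    \<open>R_cr W\<close>, so its zero lies strictly between.\<close>
  then obtain \<rho> where \<rho>: "0 \<le> \<rho>" "\<rho> \<le> 1" "tilted_moment R \<rho> = 0"
    using IVT2'[of "tilted_moment R" 1 0 0] above_R_cr(2)[OF assms(1)] continuous_tilted_moment by auto
  have "\<rho> \<noteq> 0" "\<rho> \<noteq> 1"
    using \<rho>(3) \<open>R < mean\<close> above_R_cr(2)[OF assms(1)] by (auto simp: tilted_moment_0)
  with \<rho> have \<rho>': "0 < \<rho>" "\<rho> < 1" by auto
  obtain K where K: "K > 0" "\<And>N. N \<ge> 1 \<Longrightarrow> ach_bound N R \<le> K / sqrt N * tilted_sum R \<rho> ^ N"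
    by (rule ach_bound_le[OF y0 \<rho>' \<rho>(3) R]) (rule that; assumption)
  have "E_r W R \<le> - ln (tilted_sum R \<rho>)"
  proof (rule E_r_le)
    fix \<rho>'
    have "tilted_sum R \<rho> \<le> tilted_sum R \<rho>'" using tilted_sum_tangent[of R \<rho> \<rho>'] \<rho>(3) by simp
    then show "- ln (mgf \<rho>') - \<rho>' * R \<le> - ln (tilted_sum R \<rho>)"
      using tilted_sum_pos by (simp flip: ln_tilted_sum)
  qed
  then have "tilted_sum R \<rho> \<le> exp (- E_r W R)"
    using tilted_sum_pos[of R \<rho>] by (subst ln_le_cancel_iff[symmetric]) auto
  then have pow: "tilted_sum R \<rho> ^ N \<le> exp (- real N * E_r W R)" for N
    using power_mono[of "tilted_sum R \<rho>" "exp (- E_r W R)" N] tilted_sum_pos[of R \<rho>]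
    by (simp add: exp_of_nat_mult[symmetric])
  have "Pe W N R \<le> K / sqrt (real N) * exp (- real N * E_r W R)" if N: "N \<ge> 1" for N
  proof -
    have "Pe W N R \<le> K / sqrt N * tilted_sum R \<rho> ^ N" using Pe_le K(2)[OF N] by (rule order_trans)
    also have "\<dots> \<le> K / sqrt N * exp (- real N * E_r W R)" using K(1) by (intro mult_left_mono pow) simp
    finally show ?thesis .
  qed
  then show ?thesis using K(1) by blast
qed

lemma Pe_fb_lower:
  assumes "R_inf W < R" "R < capacity W"
  shows "\<exists>K>0. \<forall>N\<ge>1. K / sqrt (real N) * exp (- real N * real_of_ereal (E_SP W R)) \<le> Pe_fb W N R"
proof -
  obtain y0 where y0: "q y0 > 0" "z y0 < R" using above_R_inf(2)[OF assms(1)] by blast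
  have "R < mean" using assms(2) capacity_le_mean by simp
  then obtain \<rho> where \<rho>: "\<rho> > 0" "tilted_moment R \<rho> = 0"
    by (rule ex_tilt[OF y0]) (rule that; assumption)
  obtain K N0 where K: "K > 0" "\<And>N. N \<ge> N0 \<Longrightarrow> K / sqrt N * tilted_sum R \<rho> ^ N \<le> Pe_fb W N R"
    by (rule Pe_fb_asymptotic[OF y0 \<rho>]) (rule that; assumption)
  define b where "b N = exp (- real N * real_of_ereal (E_SP W R)) / sqrt (real N)" for N
  have "- ln (tilted_sum R \<rho>) \<le> real_of_ereal (E_SP W R)"
    using real_E_SP_ge[OF above_R_inf(1)[OF assms(1)]] \<rho>(1) by simp
  then have "exp (- real_of_ereal (E_SP W R)) \<le> tilted_sum R \<rho>"
    using tilted_sum_pos[of R \<rho>] by (subst ln_le_cancel_iff[symmetric]) auto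
  then have "exp (- real N * real_of_ereal (E_SP W R)) \<le> tilted_sum R \<rho> ^ N" for N
    using power_mono[of "exp (- real_of_ereal (E_SP W R))" "tilted_sum R \<rho>" N]
    by (simp add: exp_of_nat_mult[symmetric])
  then have "K / sqrt N * exp (- real N * real_of_ereal (E_SP W R)) \<le> K / sqrt N * tilted_sum R \<rho> ^ N" for N
    using K(1) by (intro mult_left_mono) auto
  then have large: "K * b N \<le> Pe_fb W N R" if "N \<ge> N0" for N
    using K(2)[OF that] order_trans by (fastforce simp: b_def)
  \<comment> \<open>The constant K works from N0 on; each smaller blocklength has a positive ratio,
    and a minimum of finitely many positive numbers is positive.\<close>
  define c where "c = Min (insert K ((\<lambda>N. Pe_fb W N R / b N) ` {1..N0}))"
  have b: "b N > 0" if "N \<ge> 1" for N using that by (simp add: b_def)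
  have "c > 0"
    unfolding c_def using K(1) b Pe_fb_pos[OF y0] by (subst Min_gr_iff) auto
  moreover have "c * b N \<le> Pe_fb W N R" if N: "N \<ge> 1" for N
  proof (cases "N \<ge> N0")
    case True
    have "c \<le> K" unfolding c_def by (intro Min_le) auto
    then have "c * b N \<le> K * b N" using b[OF N] by (intro mult_right_mono) auto
    then show ?thesis using large[OF True] by simp
  next
    case False
    then have "c \<le> Pe_fb W N R / b N" unfolding c_def using N by (intro Min_le) auto
    then show ?thesis using b[OF N] by (simp add: pos_le_divide_eq)
  qed
  ultimately show ?thesis by (auto simp: b_def)
qed

end

theorem theorem2:
  fixes W :: "'x::finite \<Rightarrow> 'y::finite \<Rightarrow> real"
  assumes "is_channel W" and "symmetric_channel W" and "singular_channel W"
    and "R_cr W < capacity W"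
  shows "(\<forall>R. R_cr W < R \<and> R < capacity W \<longrightarrow>
            (\<exists>K2>0. \<forall>N::nat. N \<ge> 1 \<longrightarrow>
               Pe W N R \<le> K2 / sqrt (real N) * exp (- real N * E_r W R)))
       \<and> (\<forall>R. R_inf W < R \<and> R < capacity W \<longrightarrow>
            (\<exists>K2>0. \<forall>N::nat. N \<ge> 1 \<longrightarrow>
               Pe_fb W N R \<ge> K2 / sqrt (real N) * exp (- real N * real_of_ereal (E_SP W R))))"
proof -
  interpret singular_symmetric_channel W
    using assms by unfold_locales
  show ?thesis using Pe_upper Pe_fb_lower by blast
qed

end
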